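(* Let $R$ be a commutative Noetherian ring of finite Krull dimension. If $f\colon M\to N$ is a homomorphism of finitely generated $R$-modules and $V\subseteq N$ is an open submodule, then $f^{-1}(V)$ is an open submodule of $M$. In particular, if $U\subseteq M$ is an open submodule and $N\subseteq M$ is an arbitrary submodule, then $N\cap U$ is open in $N$.
   Context: Ordinal length: for a Noetherian module $M$, define recursively for submodules $N\subseteq M$ the height rank $\mathfrak l(M)=0$ and $\mathfrak l(N)=\sup\{\mathfrak l(N')+1 : N\subsetneq N'\subseteq M\}$ (an ordinal). Then $\operatorname{len}(M):=\mathfrak l(0)$; equivalently, it is the supremum of the order types of chains of non-zero submodules of $M$, well-ordered by reverse inclusion. A submodule $U\subseteq M$ is called open (in $M$) if $\operatorname{len}(U)=\operatorname{len}(M)$. *)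

theory Defs
  imports "HOL-Algebra.Algebra" "HOL-Library.Extended_Nat"
begin

section \<open>Ordinals\<close>

text \<open>
  An element of \<open>'a ordinal\<close> is an isomorphism class of well-orders whose field is a subset of
  \<open>'a\<close>, i.e. an ordinal of cardinality at most that of \<open>'a\<close>. HOL has no type of all
  ordinals, so \<open>'a\<close> must be large enough for the application; the lemmas
  \<open>ordinal_rank_bounded\<close> and \<open>height_rank_unfold\<close> below show that for height ranks of
  submodules \<open>N :: 'b set\<close> the choice \<open>'a = 'b set\<close> always is.
\<close>

quotient_type 'a ordinal = "'a rel" / partial: "\<lambda>r s. (r, s) \<in> ordIso"
proof (rule part_equivpI)
  show "\<exists>r :: 'a rel. (r, r) \<in> ordIso"
    by (metis ordIso_reflexive well_order_on_empty Field_empty)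
  show "symp (\<lambda>(r :: 'a rel) s. (r, s) \<in> ordIso)"
    by (rule sympI) (rule ordIso_symmetric)
  show "transp (\<lambda>(r :: 'a rel) s. (r, s) \<in> ordIso)"
    by (rule transpI) (rule ordIso_transitive)
qed

instantiation ordinal :: (type) wellorder
begin

lift_definition less_eq_ordinal :: "'a ordinal \<Rightarrow> 'a ordinal \<Rightarrow> bool"
  is "\<lambda>r s. (r, s) \<in> ordLeq"
  by (meson ordIso_ordLeq_trans ordIso_symmetric ordLeq_ordIso_trans)

lift_definition less_ordinal :: "'a ordinal \<Rightarrow> 'a ordinal \<Rightarrow> bool"
  is "\<lambda>r s. (r, s) \<in> ordLess"
  by (meson ordIso_ordLess_trans ordIso_symmetric ordLess_ordIso_trans)

instance
proof
  fix x y z :: "'a ordinal"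
  show "x < y \<longleftrightarrow> x \<le> y \<and> \<not> y \<le> x"
    by transfer (meson not_ordLess_ordLeq not_ordLeq_iff_ordLess ordLess_imp_ordLeq
        ordIso_iff_ordLeq ordLeq_iff_ordLess_or_ordIso)
  show "x \<le> x"
    by transfer (simp add: ordIso_iff_ordLeq)
  show "x \<le> y \<Longrightarrow> y \<le> z \<Longrightarrow> x \<le> z"
    by transfer (rule ordLeq_transitive)
  show "x \<le> y \<Longrightarrow> y \<le> x \<Longrightarrow> x = y"
    by transfer (simp add: ordIso_iff_ordLeq)
  show "x \<le> y \<or> y \<le> x"
    by transfer (meson ordIso_iff_ordLeq ordLeq_Well_order_simp ordLeq_total)
next
  fix P :: "'a ordinal \<Rightarrow> bool" and a
  assume step: "\<And>x. (\<And>y. y < x \<Longrightarrow> P y) \<Longrightarrow> P x"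
  have "wf {(x, y :: 'a ordinal). x < y}"
  proof (rule wf_subset)
    show "wf (inv_image ordLess (rep_ordinal :: 'a ordinal \<Rightarrow> _))"
      by (rule wf_inv_image) (rule wf_ordLess)
    show "{(x, y :: 'a ordinal). x < y} \<subseteq> inv_image ordLess rep_ordinal"
      by (auto simp: less_ordinal_def)
  qed
  then show "P a"
    by (induction a rule: wf_induct_rule) (use step in blast)
qed

end

definition osucc :: "'a ordinal \<Rightarrow> 'a ordinal" where
  "osucc \<alpha> = (LEAST \<beta>. \<alpha> < \<beta>)"

definition osup :: "'a ordinal set \<Rightarrow> 'a ordinal" where
  "osup A = (LEAST \<beta>. \<forall>\<alpha>\<in>A. \<alpha> \<le> \<beta>)"

lemma no_inj_ordinal: "\<not> inj (g :: 'a ordinal \<Rightarrow> 'a)"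
proof
  assume g: "inj g"
  define r where "r = {(g \<alpha>, g \<beta>) | \<alpha> \<beta>. \<alpha> \<le> \<beta>}"
  have Field_r: "Field r = range g"
    by (auto simp: r_def Field_def)
  have in_r: "(g \<alpha>, g \<beta>) \<in> r \<longleftrightarrow> \<alpha> \<le> \<beta>" for \<alpha> \<beta>
    using g by (auto simp: r_def inj_def)
  have wo: "Well_order r"
    unfolding well_order_on_def linear_order_on_def partial_order_on_def preorder_on_def
  proof (intro conjI)
    show "r \<subseteq> Field r \<times> Field r" by (auto simp: Field_def)
    show "refl_on (Field r) r" by (auto simp: refl_on_def Field_r in_r)
    show "trans r"
    proof (rule transI)
      fix x y z assume "(x, y) \<in> r" "(y, z) \<in> r"
      then obtain \<alpha> \<beta> \<gamma> \<delta> where "x = g \<alpha>" "y = g \<beta>" "\<alpha> \<le> \<beta>" "y = g \<gamma>" "z = g \<delta>" "\<gamma> \<le> \<delta>"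
        unfolding r_def by blast
      then show "(x, z) \<in> r"
        using injD[OF g, of \<beta> \<gamma>] by (auto simp: in_r)
    qed
    show "antisym r" by (rule antisymI) (auto simp: r_def inj_eq[OF g])
    show "total_on (Field r) r" by (auto simp: total_on_def Field_r in_r)
    have "r - Id \<subseteq> inv_image {(x, y). x < y} (inv_into UNIV g)"
      using g by (auto simp: r_def inj_def)
    then show "wf (r - Id)"
      by (rule wf_subset[OF wf_inv_image[OF wf]])
  qed
  define seg where "seg = (\<lambda>\<alpha>. Restr r (underS r (g \<alpha>)))"
  define h where "h = (\<lambda>\<alpha>. abs_ordinal (seg \<alpha>))"
  have seg_wo: "Well_order (seg \<alpha>)" for \<alpha>
    unfolding seg_def by (rule Well_order_Restr[OF wo])
  have less_abs: "abs_ordinal s < abs_ordinal t \<longleftrightarrow> (s, t) \<in> ordLess"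
    if "Well_order s" "Well_order t" for s t :: "'a rel"
    using that by (simp add: less_ordinal.abs_eq ordIso_reflexive)
  have h_less: "h \<alpha> < abs_ordinal r" for \<alpha>
    unfolding h_def
    by (subst less_abs[OF seg_wo wo])
      (auto simp: seg_def Field_r intro!: underS_Restr_ordLess[OF wo])
  have underS_eq: "underS r (g \<alpha>) = g ` {\<beta>. \<beta> < \<alpha>}" for \<alpha>
    using g by (auto simp: underS_def r_def inj_def less_le)
  have h_mono: "h \<alpha> < h \<beta>" if "\<alpha> < \<beta>" for \<alpha> \<beta>
  proof -
    have "underS r (g \<alpha>) \<subset> underS r (g \<beta>)"
    proof -
      have "underS r (g \<alpha>) \<subseteq> underS r (g \<beta>)"
        using that by (auto simp: underS_eq)
      moreover have "g \<alpha> \<in> underS r (g \<beta>)" "g \<alpha> \<notin> underS r (g \<alpha>)"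
        using that by (auto simp: underS_eq inj_eq[OF g])
      ultimately show ?thesis by blast
    qed
    moreover have "wo_rel.ofilter r (underS r (g \<alpha>))" "wo_rel.ofilter r (underS r (g \<beta>))"
      using wo by (auto simp: wo_rel_def wo_rel.underS_ofilter)
    ultimately have "(seg \<alpha>, seg \<beta>) \<in> ordLess"
      unfolding seg_def using ofilter_subset_ordLess[OF wo] by blast
    then show ?thesis
      unfolding h_def by (simp add: less_abs seg_wo)
  qed
  have "\<alpha> \<le> h \<alpha>" for \<alpha>
  proof (induction \<alpha> rule: less_induct)
    case (less \<alpha>)
    then show ?case
      using h_mono[of "h \<alpha>" \<alpha>] by (meson leD not_le)
  qed
  with h_less show False
    by (meson leD)
qed

lemma ordinal_rank_bounded:
  fixes h :: "'a \<Rightarrow> 'a ordinal"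
  assumes "\<And>\<alpha> x. x \<in> S \<Longrightarrow> \<alpha> < h x \<Longrightarrow> \<alpha> \<in> h ` S"
  shows "\<exists>\<beta>. \<forall>x\<in>S. h x < \<beta>"
proof (rule ccontr)
  assume "\<not> ?thesis"
  then have "\<exists>x\<in>S. \<beta> \<le> h x" for \<beta>
    by (meson not_le)
  then have "\<beta> \<in> h ` S" for \<beta>
    using assms by (metis image_eqI order_le_less)
  then have "surj h"
    by blast
  then have "inj (inv_into UNIV h)"
    by (rule surj_imp_inj_inv)
  then show False
    using no_inj_ordinal by blast
qed


section \<open>Krull dimension, modules and homomorphisms\<close>

text \<open>
  The supremum is taken in \<^typ>\<open>enat\<close>; the zero ring, which has no prime ideals, gets dimension
  \<open>0\<close>.
\<close>

definition krull_dim :: "('a, 'r) ring_scheme \<Rightarrow> enat" where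
  "krull_dim R = Sup {enat n | n. \<exists>P :: nat \<Rightarrow> 'a set.
     (\<forall>i\<le>n. primeideal (P i) R) \<and> (\<forall>i<n. P i \<subset> P (Suc i))}"

definition generated_submodule ::
  "('a, 'r) ring_scheme \<Rightarrow> ('a, 'b, 'm) module_scheme \<Rightarrow> 'b set \<Rightarrow> 'b set" where
  "generated_submodule R M S = \<Inter> {N. submodule N R M \<and> S \<subseteq> N}"

definition fin_gen_module ::
  "('a, 'r) ring_scheme \<Rightarrow> ('a, 'b, 'm) module_scheme \<Rightarrow> bool" where
  "fin_gen_module R M \<longleftrightarrow> module R M \<and>
     (\<exists>S \<subseteq> carrier M. finite S \<and> carrier M = generated_submodule R M S)"

definition mod_hom ::
  "('a, 'r) ring_scheme \<Rightarrow> ('a, 'b, 'm) module_scheme \<Rightarrow> ('a, 'c, 'n) module_scheme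
    \<Rightarrow> ('b \<Rightarrow> 'c) set" where
  "mod_hom R M N = {f \<in> hom (add_monoid M) (add_monoid N).
     \<forall>a\<in>carrier R. \<forall>x\<in>carrier M. f (a \<odot>\<^bsub>M\<^esub> x) = a \<odot>\<^bsub>N\<^esub> f x}"


section \<open>Ordinal length and open submodules\<close>

definition submodule_above ::
  "('a, 'r) ring_scheme \<Rightarrow> ('a, 'b, 'm) module_scheme \<Rightarrow> ('b set \<times> 'b set) set" where
  "submodule_above R M = {(N', N). submodule N R M \<and> submodule N' R M \<and> N \<subset> N'}"

text \<open>
  The recursion is along \<^const>\<open>submodule_above\<close>, which is well-founded exactly when the
  submodules of \<open>M\<close> satisfy the ascending chain condition.
\<close>

definition height_rank ::
  "('a, 'r) ring_scheme \<Rightarrow> ('a, 'b, 'm) module_scheme \<Rightarrow> 'b set \<Rightarrow> 'b set ordinal" where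
  "height_rank R M = wfrec (submodule_above R M)
     (\<lambda>h N. osup {osucc (h N') | N'. (N', N) \<in> submodule_above R M})"

definition len ::
  "('a, 'r) ring_scheme \<Rightarrow> ('a, 'b, 'm) module_scheme \<Rightarrow> 'b set ordinal" where
  "len R M = height_rank R M {\<zero>\<^bsub>M\<^esub>}"

definition open_submodule ::
  "('a, 'r) ring_scheme \<Rightarrow> ('a, 'b, 'm) module_scheme \<Rightarrow> 'b set \<Rightarrow> bool" where
  "open_submodule R M U \<longleftrightarrow> submodule U R M \<and> len R (M\<lparr>carrier := U\<rparr>) = len R M"

text \<open>
  The defining recursion of the height rank. The second part says that the successors and the
  supremum in it are genuine, i.e. not artefacts of \<open>LEAST\<close> applied to an empty condition.
\<close>

lemma height_rank_unfold:
  assumes wf: "wf (submodule_above R M)"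
  shows "height_rank R M N =
      osup {osucc (height_rank R M N') | N'. (N', N) \<in> submodule_above R M}"
    and "(N', N) \<in> submodule_above R M \<Longrightarrow>
      height_rank R M N' < osucc (height_rank R M N') \<and>
      osucc (height_rank R M N') \<le> height_rank R M N"
proof -
  let ?A = "submodule_above R M" and ?h = "height_rank R M"
  have unfold: "?h N = osup {osucc (?h N') | N'. (N', N) \<in> ?A}" for N
  proof -
    have "?h N = osup {osucc (cut ?h ?A N N') | N'. (N', N) \<in> ?A}"
      unfolding height_rank_def by (subst wfrec[OF wf]) simp
    also have "{osucc (cut ?h ?A N N') | N'. (N', N) \<in> ?A} = {osucc (?h N') | N'. (N', N) \<in> ?A}"
      by (force simp: cut_apply)
    finally show ?thesis .
  qed
  then show "?h N = osup {osucc (?h N') | N'. (N', N) \<in> ?A}" .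
  have trans: "(N'', N) \<in> ?A" if "(N'', N') \<in> ?A" "(N', N) \<in> ?A" for N N' N''
    using that by (auto simp: submodule_above_def)
  have main: "(\<forall>N'. (N', N) \<in> ?A \<longrightarrow> ?h N' < osucc (?h N') \<and> osucc (?h N') \<le> ?h N) \<and>
      (\<forall>\<alpha><?h N. \<exists>N'. (N', N) \<in> ?A \<and> ?h N' = \<alpha>)" for N
    using wf
  proof (induction N rule: wf_induct_rule)
    case (less N)
    let ?S = "{N'. (N', N) \<in> ?A}"
    have "\<exists>\<beta>. \<forall>N'\<in>?S. ?h N' < \<beta>"
      by (rule ordinal_rank_bounded) (use less trans in blast)
    then obtain \<beta> where \<beta>: "\<And>N'. (N', N) \<in> ?A \<Longrightarrow> ?h N' < \<beta>"
      by blast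
    have succ: "?h N' < osucc (?h N')" "osucc (?h N') \<le> \<gamma>"
      if "(N', N) \<in> ?A" "?h N' < \<gamma>" for N' \<gamma>
      unfolding osucc_def using that by (auto intro: LeastI Least_le)
    have le: "osucc (?h N') \<le> ?h N" if "(N', N) \<in> ?A" for N'
    proof -
      have "\<forall>\<alpha>\<in>{osucc (?h N') | N'. (N', N) \<in> ?A}. \<alpha> \<le> osup {osucc (?h N') | N'. (N', N) \<in> ?A}"
        unfolding osup_def by (rule LeastI[of _ \<beta>]) (use \<beta> succ in blast)
      then show ?thesis
        using that unfolding unfold[of N] by blast
    qed
    have "\<exists>N'. (N', N) \<in> ?A \<and> ?h N' = \<alpha>" if \<alpha>: "\<alpha> < ?h N" for \<alpha>
    proof -
      have "\<not> (\<forall>\<gamma>\<in>{osucc (?h N') | N'. (N', N) \<in> ?A}. \<gamma> \<le> \<alpha>)"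
        using \<alpha> unfolding unfold[of N] osup_def by (rule not_less_Least)
      then obtain N' where N': "(N', N) \<in> ?A" "\<not> osucc (?h N') \<le> \<alpha>"
        by blast
      then have "\<alpha> \<le> ?h N'"
        using succ(2) by (meson not_le)
      then show ?thesis
        using N'(1) less trans by (metis order_le_less)
    qed
    with le succ(1) \<beta> show ?case
      by blast
  qed
  show "?h N' < osucc (?h N') \<and> osucc (?h N') \<le> ?h N" if "(N', N) \<in> ?A"
    using main that by blast
qed

end

theory Submission
  imports Defs
begin

text \<open>
  The argument takes place in the modular Noetherian lattice of submodules. Call an interval small at
  level \<open>a\<close> if it is trivial or has finite length at some level below \<open>a\<close>, where length at level
  \<open>a\<close> counts the steps of a chain that are not small at level \<open>a\<close>. In \<open>[A, B]\<close> there is a largest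
  \<open>T\<close> such that \<open>[A, T]\<close> has finite length at level \<open>a\<close>; that length is the coefficient of the
  interval at \<open>a\<close>. Enlarging \<open>A\<close> strictly lowers the coefficient sequence in the lexicographic order
  (largest level first), and every lexicographically smaller sequence with a largest element in each
  nonempty part of its support is reached or exceeded by some enlargement. Hence ordinal lengths are
  compared like coefficient sequences, and \<open>U\<close> is open in \<open>M\<close> iff every submodule \<open>K\<close> of finite
  length at level \<open>a\<close> has \<open>(U + K)/U\<close> small at level \<open>a\<close>. This criterion passes to preimages because
  submodules of \<open>M\<close> above the kernel of \<open>f\<close> correspond to submodules of its image.
\<close>

section \<open>Lengths of chains in modular lattices\<close>

declare not_infinity_eq [simp del]

text \<open>A chain from \<open>A\<close> to \<open>B\<close> in which \<open>n\<close> links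
  outside \<open>Z\<close> have been selected for counting. Since \<open>skip\<close> accepts every
  link, counting is optional, so the possible \<open>n\<close> are closed downwards.\<close>

inductive steps :: "'b set set \<Rightarrow> ('b set \<Rightarrow> 'b set \<Rightarrow> bool) \<Rightarrow> 'b set \<Rightarrow> 'b set \<Rightarrow> nat \<Rightarrow> bool"
  for L Z where
  refl: "A \<in> L \<Longrightarrow> steps L Z A A 0"
| skip: "A \<in> L \<Longrightarrow> A \<subseteq> B \<Longrightarrow> steps L Z B C n \<Longrightarrow> steps L Z A C n"
| step: "A \<in> L \<Longrightarrow> A \<subseteq> B \<Longrightarrow> \<not> Z A B \<Longrightarrow> steps L Z B C n \<Longrightarrow> steps L Z A C (Suc n)"

definition slen :: "'b set set \<Rightarrow> ('b set \<Rightarrow> 'b set \<Rightarrow> bool) \<Rightarrow> 'b set \<Rightarrow> 'b set \<Rightarrow> enat" where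
  "slen L Z A B = (SUP n\<in>{n. steps L Z A B n}. enat n)"

lemma steps_in: "steps L Z A B n \<Longrightarrow> A \<in> L \<and> B \<in> L \<and> A \<subseteq> B"
  by (induction rule: steps.induct) auto

lemma steps_append: "steps L Z A B m \<Longrightarrow> steps L Z B C n \<Longrightarrow> steps L Z A C (m + n)"
  by (induction rule: steps.induct) (auto intro: steps.intros)

lemma steps_pred: "steps L Z A B n \<Longrightarrow> m \<le> n \<Longrightarrow> steps L Z A B m"
proof (induction arbitrary: m rule: steps.induct)
  case (step A B C n)
  then show ?case
    by (cases m) (auto intro: steps.intros)
qed (auto intro: steps.intros)

lemma steps_zero: "A \<in> L \<Longrightarrow> B \<in> L \<Longrightarrow> A \<subseteq> B \<Longrightarrow> steps L Z A B 0"
  by (auto intro: steps.intros)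

lemma steps_one: "A \<in> L \<Longrightarrow> B \<in> L \<Longrightarrow> A \<subseteq> B \<Longrightarrow> \<not> Z A B \<Longrightarrow> steps L Z A B 1"
  by (auto intro: steps.intros)

lemma steps_first_step:
  "steps L Z A B (Suc n) \<Longrightarrow> \<exists>C D. C \<in> L \<and> D \<in> L \<and> A \<subseteq> C \<and> C \<subseteq> D \<and> \<not> Z C D \<and> steps L Z D B n"
proof (induction A B "Suc n" rule: steps.induct)
  case (skip A A' B)
  then obtain C D where "C \<in> L" "D \<in> L" "A' \<subseteq> C" "C \<subseteq> D" "\<not> Z C D" "steps L Z D B n"
    by blast
  then show ?case using skip(2) by (intro exI[of _ C] exI[of _ D]) auto
next
  case (step A A' B)
  then show ?case
    using steps_in[OF step(4)] by (intro exI[of _ A] exI[of _ A']) auto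
qed

lemma steps_first_proper:
  assumes "\<And>A. A \<in> L \<Longrightarrow> Z A A"
  shows "steps L Z A B (Suc n) \<Longrightarrow> \<exists>C\<in>L. A \<subset> C \<and> C \<subseteq> B \<and> steps L Z C B n"
proof (induction A B "Suc n" rule: steps.induct)
  case (skip A A' B)
  show ?case
  proof (cases "A = A'")
    case False
    moreover have "steps L Z A' B n" using steps_pred[OF skip(3), of n] by simp
    ultimately show ?thesis
      using skip(2) steps_in[OF skip(3)] by (intro bexI[of _ A']) auto
  qed (use skip in simp)
next
  case (step A A' B)
  have "A \<noteq> A'" using step assms by metis
  then show ?case
    using step steps_in[OF step(4)] by (intro bexI[of _ A']) auto
qed

lemma steps_le_slen: "steps L Z A B n \<Longrightarrow> enat n \<le> slen L Z A B"
  unfolding slen_def by (rule SUP_upper) simp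

text \<open>The possible counts contain 0 and are closed downwards, so every finite bound below the
  supremum is attained, also when the supremum is infinite.\<close>

lemma le_slen_steps:
  assumes "A \<in> L" "B \<in> L" "A \<subseteq> B"
  shows "enat n \<le> slen L Z A B \<longleftrightarrow> steps L Z A B n"
proof
  assume n: "enat n \<le> slen L Z A B"
  show "steps L Z A B n"
  proof (rule ccontr)
    assume "\<not> steps L Z A B n"
    then have *: "m < n" if "steps L Z A B m" for m
      using that steps_pred by (metis not_le)
    have "n > 0" using * steps_zero[OF assms] by blast
    have "slen L Z A B \<le> enat (n - 1)"
      unfolding slen_def by (rule SUP_least) (use * in force)
    with n have "enat n \<le> enat (n - 1)" by (rule order_trans)
    with \<open>n > 0\<close> show False by simp
  qed
qed (rule steps_le_slen)

lemma slen_le: "(\<And>n. steps L Z A B n \<Longrightarrow> enat n \<le> x) \<Longrightarrow> slen L Z A B \<le> x"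
  unfolding slen_def by (rule SUP_least) simp

lemma enat_le_iff: "x \<le> y \<longleftrightarrow> (\<forall>n. enat n \<le> x \<longrightarrow> enat n \<le> (y::enat))"
proof safe
  assume *: "\<forall>n. enat n \<le> x \<longrightarrow> enat n \<le> y"
  show "x \<le> y"
  proof (cases y)
    case (enat m)
    then show ?thesis using *[rule_format, of "Suc m"]
      by (metis Suc_ile_eq enat_ord_simps(2) less_irrefl not_le)
  qed simp
qed (rule order_trans)

section \<open>Modular lattices with the ascending chain condition\<close>

locale noetherian_modular =
  fixes L :: "'b set set" and J :: "'b set \<Rightarrow> 'b set \<Rightarrow> 'b set"
  assumes Int_in [simp]: "A \<in> L \<Longrightarrow> B \<in> L \<Longrightarrow> A \<inter> B \<in> L"
    and J_in [simp]: "A \<in> L \<Longrightarrow> B \<in> L \<Longrightarrow> J A B \<in> L"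
    and J_ub1: "A \<in> L \<Longrightarrow> B \<in> L \<Longrightarrow> A \<subseteq> J A B"
    and J_ub2: "A \<in> L \<Longrightarrow> B \<in> L \<Longrightarrow> B \<subseteq> J A B"
    and J_least: "A \<in> L \<Longrightarrow> B \<in> L \<Longrightarrow> C \<in> L \<Longrightarrow> A \<subseteq> C \<Longrightarrow> B \<subseteq> C \<Longrightarrow> J A B \<subseteq> C"
    and modular: "A \<in> L \<Longrightarrow> B \<in> L \<Longrightarrow> C \<in> L \<Longrightarrow> A \<subseteq> C \<Longrightarrow> J A B \<inter> C \<subseteq> J A (B \<inter> C)"
    and acc: "wf {(B, A). A \<in> L \<and> B \<in> L \<and> A \<subset> B}"
begin

lemma J_commute: "A \<in> L \<Longrightarrow> B \<in> L \<Longrightarrow> J A B = J B A"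
  by (simp add: J_least J_ub1 J_ub2 subset_antisym)

lemma J_mono: "A \<in> L \<Longrightarrow> A' \<in> L \<Longrightarrow> B \<in> L \<Longrightarrow> B' \<in> L \<Longrightarrow> A \<subseteq> A' \<Longrightarrow> B \<subseteq> B' \<Longrightarrow> J A B \<subseteq> J A' B'"
  by (meson J_in J_least J_ub1 J_ub2 order_trans)

lemma J_absorb1: "A \<in> L \<Longrightarrow> B \<in> L \<Longrightarrow> A \<subseteq> B \<Longrightarrow> J A B = B"
  by (simp add: J_least J_ub2 subset_antisym)

lemma J_absorb2: "A \<in> L \<Longrightarrow> B \<in> L \<Longrightarrow> B \<subseteq> A \<Longrightarrow> J A B = A"
  by (simp add: J_least J_ub1 subset_antisym)

lemma maximal_element:
  assumes "S \<subseteq> L" "S \<noteq> {}"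
  obtains T where "T \<in> S" "\<And>T'. T' \<in> S \<Longrightarrow> \<not> T \<subset> T'"
proof -
  have "\<exists>T\<in>S. \<forall>T'. (T', T) \<in> {(B, A). A \<in> L \<and> B \<in> L \<and> A \<subset> B} \<longrightarrow> T' \<notin> S"
    using acc assms(2) unfolding wf_eq_minimal by auto
  then obtain T where
    T: "T \<in> S" "\<And>T'. (T', T) \<in> {(B, A). A \<in> L \<and> B \<in> L \<and> A \<subset> B} \<Longrightarrow> T' \<notin> S"
    by auto
  have "\<not> T \<subset> T'" if "T' \<in> S" for T'
    using T(2)[of T'] T(1) that assms(1) by auto
  with T(1) show ?thesis by (rule that)
qed

end

text \<open>The lattice counterpart of a Serre subcategory: null intervals are stable under
  subdivision, concatenation and perspectivity.\<close>

locale serre_relation = noetherian_modular +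
  fixes Z :: "'b set \<Rightarrow> 'b set \<Rightarrow> bool"
  assumes Z_refl: "A \<in> L \<Longrightarrow> Z A A"
    and Z_trans: "A \<in> L \<Longrightarrow> B \<in> L \<Longrightarrow> C \<in> L \<Longrightarrow> A \<subseteq> B \<Longrightarrow> B \<subseteq> C \<Longrightarrow> Z A C \<longleftrightarrow> Z A B \<and> Z B C"
    and Z_perspective: "A \<in> L \<Longrightarrow> B \<in> L \<Longrightarrow> Z (A \<inter> B) A \<longleftrightarrow> Z B (J A B)"
begin

text \<open>The two links of \<open>A \<subseteq> J A (A' \<inter> B) \<subseteq> A'\<close> are
  perspective to \<open>[A \<inter> B, A' \<inter> B]\<close> and to \<open>[J A B, J A' B]\<close>,
  so both are null.\<close>

lemma null_step_split:
  assumes L: "A \<in> L" "A' \<in> L" "B \<in> L" and le: "A \<subseteq> A'"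
    and 1: "Z (A \<inter> B) (A' \<inter> B)" and 2: "Z (J A B) (J A' B)"
  shows "Z A A'"
proof -
  let ?X = "J A (A' \<inter> B)"
  note [simp] = L
  have X: "?X \<in> L" "A \<subseteq> ?X" "?X \<subseteq> A'"
    by (simp_all add: J_ub1 J_least le)
  have "Z A ?X"
  proof -
    have "(A' \<inter> B) \<inter> A = A \<inter> B" using le by blast
    then show ?thesis using Z_perspective[of "A' \<inter> B" A] 1 by (simp add: J_commute)
  qed
  moreover have "Z ?X A'"
  proof -
    \<comment> \<open>One inclusion is the modular law; the equation makes the second link
      perspective to \<open>[J A B, J A' B]\<close>.\<close>
    have "A' \<inter> J A B = ?X"
    proof
      show "A' \<inter> J A B \<subseteq> ?X"
        using modular[of A B A'] le by (auto simp: Int_commute)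
      show "?X \<subseteq> A' \<inter> J A B"
        using X(3) J_mono[of A A "A' \<inter> B" B] by simp
    qed
    moreover have "J A' (J A B) = J A' B"
      by (intro subset_antisym) (simp_all add: J_least J_mono J_ub1 J_ub2 le
          subset_trans[OF J_ub2 J_mono[of A A' B B]] subset_trans[OF J_ub2[of A B] J_ub2[of A' "J A B"]])
    ultimately show ?thesis using Z_perspective[of A' "J A B"] 2 by simp
  qed
  ultimately show ?thesis using Z_trans[of A ?X A'] X by simp
qed

text \<open>By \<open>null_step_split\<close> each counted step stays non-null in at least one of
  the two projections \<open>X \<inter> B\<close> and \<open>J X B\<close>, so it can be counted
  there.\<close>

lemma steps_split:
  assumes "steps L Z A C n" "B \<in> L"
  shows "\<exists>k m. steps L Z (A \<inter> B) (C \<inter> B) k \<and> steps L Z (J A B) (J C B) m \<and> n \<le> k + m"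
  using assms
proof (induction rule: steps.induct)
  case (refl A)
  then show ?case by (auto intro!: steps.refl exI[of _ 0])
next
  case (skip A A' C n)
  then obtain k m where km: "steps L Z (A' \<inter> B) (C \<inter> B) k" "steps L Z (J A' B) (J C B) m" "n \<le> k + m"
    by blast
  have A': "A' \<in> L" using skip steps_in by blast
  have "A \<inter> B \<subseteq> A' \<inter> B" "J A B \<subseteq> J A' B" "A \<inter> B \<in> L" "J A B \<in> L"
    using skip A' by (auto simp: J_mono Int_mono)
  then have "steps L Z (A \<inter> B) (C \<inter> B) k" "steps L Z (J A B) (J C B) m"
    using km steps.skip by blast+
  then show ?case using km(3) by blast
next
  case (step A A' C n)
  then obtain k m where km: "steps L Z (A' \<inter> B) (C \<inter> B) k" "steps L Z (J A' B) (J C B) m" "n \<le> k + m"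
    by blast
  have A': "A' \<in> L" using step steps_in by blast
  have le: "A \<inter> B \<subseteq> A' \<inter> B" "J A B \<subseteq> J A' B"
    using step A' by (auto simp: J_mono Int_mono)
  have in_L: "A \<inter> B \<in> L" "J A B \<in> L" using step by auto
  note sk = steps.skip[OF in_L(1) le(1) km(1)] steps.skip[OF in_L(2) le(2) km(2)]
  have "\<not> Z (A \<inter> B) (A' \<inter> B) \<or> \<not> Z (J A B) (J A' B)"
    using null_step_split[of A A' B] step A' by blast
  then show ?case
  proof
    assume "\<not> Z (A \<inter> B) (A' \<inter> B)"
    from steps.step[OF in_L(1) le(1) this km(1)] sk(2) km(3) show ?thesis
      by (intro exI[of _ "Suc k"] exI[of _ m]) auto
  next
    assume "\<not> Z (J A B) (J A' B)"
    from steps.step[OF in_L(2) le(2) this km(2)] sk(1) km(3) show ?thesis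
      by (intro exI[of _ k] exI[of _ "Suc m"]) auto
  qed
qed

lemma slen_split:
  assumes "A \<in> L" "C \<in> L" "B \<in> L" "A \<subseteq> C"
  shows "slen L Z A C \<le> slen L Z (A \<inter> B) (C \<inter> B) + slen L Z (J A B) (J C B)"
proof (rule slen_le)
  fix n assume "steps L Z A C n"
  from steps_split[OF this \<open>B \<in> L\<close>] obtain k m where
    "steps L Z (A \<inter> B) (C \<inter> B) k" "steps L Z (J A B) (J C B) m" "n \<le> k + m" by blast
  then have "enat k \<le> slen L Z (A \<inter> B) (C \<inter> B)" "enat m \<le> slen L Z (J A B) (J C B)" "enat n \<le> enat k + enat m"
    by (auto intro: steps_le_slen)
  then show "enat n \<le> slen L Z (A \<inter> B) (C \<inter> B) + slen L Z (J A B) (J C B)"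
    by (meson add_mono order_trans)
qed

text \<open>Chains project to both sides of \<open>B\<close> by \<open>slen_split\<close>, which
  bounds the length from above; concatenating chains bounds it from below.\<close>

lemma slen_add:
  assumes "A \<in> L" "B \<in> L" "C \<in> L" "A \<subseteq> B" "B \<subseteq> C"
  shows "slen L Z A C = slen L Z A B + slen L Z B C"
proof (rule antisym)
  have "A \<inter> B = A" "C \<inter> B = B" using assms by auto
  then show "slen L Z A C \<le> slen L Z A B + slen L Z B C"
    using slen_split[of A C B] assms by (simp add: J_absorb1 J_absorb2)
  show "slen L Z A B + slen L Z B C \<le> slen L Z A C"
  proof (subst enat_le_iff, safe)
    fix n assume n: "enat n \<le> slen L Z A B + slen L Z B C"
    \<comment> \<open>Either length may be infinite, so a finite bound is divided: the first
      interval takes all of \<open>n\<close> if it can, and otherwise its full finite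
      length.\<close>
    have "\<exists>k m. n = k + m \<and> enat k \<le> slen L Z A B \<and> enat m \<le> slen L Z B C"
    proof (cases "enat n \<le> slen L Z A B")
      case True
      then show ?thesis by (intro exI[of _ n] exI[of _ 0]) (auto simp: zero_enat_def[symmetric])
    next
      case False
      then obtain k where k: "slen L Z A B = enat k" "k < n"
        by (cases "slen L Z A B") auto
      then have "enat (n - k) \<le> slen L Z B C"
        using n by (cases "slen L Z B C") auto
      then show ?thesis using k by (intro exI[of _ k] exI[of _ "n - k"]) auto
    qed
    then show "enat n \<le> slen L Z A C"
      using assms steps_append by (auto simp: le_slen_steps)
  qed
qed

text \<open>A non-null interval counts as one step by itself, and a null one has only null
  subintervals.\<close>

lemma slen_eq_0_iff:
  assumes "A \<in> L" "B \<in> L" "A \<subseteq> B"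
  shows "slen L Z A B = 0 \<longleftrightarrow> Z A B"
proof
  assume "slen L Z A B = 0"
  then have "\<not> steps L Z A B 1" using steps_le_slen[of L Z A B 1]
    by (auto simp: zero_enat_def)
  then show "Z A B" using steps_one assms by blast
next
  assume Z: "Z A B"
  have "n = 0" if "steps L Z A B n" for n
    using that Z
  proof (induction rule: steps.induct)
    case (skip A B C n)
    then show ?case using steps_in[OF skip(3)] Z_trans[of A B C] by blast
  next
    case (step A B C n)
    then show ?case using steps_in[OF step(4)] Z_trans[of A B C] by blast
  qed simp
  then have "slen L Z A B \<le> 0" by (intro slen_le) (auto simp: zero_enat_def)
  then show "slen L Z A B = 0" by simp
qed

text \<open>Each inequality splits one interval by the other element; one of the two projections is
  then trivial and the other is the perspective interval.\<close>

lemma slen_perspective: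
  assumes "A \<in> L" "B \<in> L"
  shows "slen L Z (A \<inter> B) A = slen L Z B (J A B)"
proof (rule antisym)
  have 0: "slen L Z D D = 0" if "D \<in> L" for D
    using slen_eq_0_iff[of D D] Z_refl that by simp
  have "J (A \<inter> B) B = B" using assms by (simp add: J_absorb1)
  then show "slen L Z (A \<inter> B) A \<le> slen L Z B (J A B)"
    using slen_split[of "A \<inter> B" A B] assms 0[of "A \<inter> B"] by (simp add: Int_assoc)
  have "J A B \<inter> A = A" "J (J A B) A = J A B" "J B A = J A B"
    using assms J_ub1[of A B] J_commute[of B A] by (auto simp: J_absorb2)
  then show "slen L Z B (J A B) \<le> slen L Z (A \<inter> B) A"
    using slen_split[of B "J A B" A] assms 0[of "J A B"] J_ub2[of A B] by (simp add: Int_commute)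
qed

end

text \<open>
  \<open>rlen L a\<close> measures length modulo the intervals that already have finite length at a level below
  \<open>a\<close>. This is the transfinite filtration behind the Gabriel-Rentschler dimension; it replaces
  Krull dimension and localization at primes.
\<close>

definition rlen :: "'b set set \<Rightarrow> 'i::wellorder \<Rightarrow> 'b set \<Rightarrow> 'b set \<Rightarrow> enat" where
  "rlen L = wfrec {(x, y). x < y}
     (\<lambda>h a. slen L (\<lambda>C D. C = D \<or> (\<exists>g<a. h g C D < \<infinity>)))"

text \<open>At the least level only trivial intervals are small, so \<open>rlen\<close> is there the
  ordinary length and the recursion starts from it.\<close>

definition small :: "'b set set \<Rightarrow> 'i::wellorder \<Rightarrow> 'b set \<Rightarrow> 'b set \<Rightarrow> bool" where
  "small L a C D \<longleftrightarrow> C = D \<or> (\<exists>g<a. rlen L g C D < \<infinity>)"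

lemma rlen_slen: "rlen L a = slen L (small L a)"
proof -
  have "rlen L a = slen L (\<lambda>C D. C = D \<or> (\<exists>g<a. cut (rlen L) {(x, y). x < y} a g C D < \<infinity>))"
    unfolding rlen_def by (subst wfrec[OF wf]) simp
  also have "(\<lambda>C D. C = D \<or> (\<exists>g<a. cut (rlen L) {(x, y). x < y} a g C D < \<infinity>)) = small L a"
    by (intro ext) (auto simp: small_def cut_apply)
  finally show ?thesis .
qed

lemma enat_add_less_infinity_iff: "(x::enat) + y < \<infinity> \<longleftrightarrow> x < \<infinity> \<and> y < \<infinity>"
  by (cases x; cases y) auto

section \<open>Length at a given level\<close>

context noetherian_modular
begin

text \<open>By induction \<open>rlen\<close> is additive and invariant under perspectivity at all
  levels below \<open>a\<close>, and finiteness at one of these levels persists at the larger ones;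
  hence the intervals finite at some lower level satisfy the axioms.\<close>

lemma serre_small: "serre_relation L J (small L a)"
proof (induction a rule: less_induct)
  case (less a)
  have add: "rlen L g A C = rlen L g A B + rlen L g B C"
    if "g < a" "A \<in> L" "B \<in> L" "C \<in> L" "A \<subseteq> B" "B \<subseteq> C" for g A B C
    unfolding rlen_slen using serre_relation.slen_add[OF less[OF that(1)]] that by blast
  have persp: "rlen L g (A \<inter> B) A = rlen L g B (J A B)"
    if "g < a" "A \<in> L" "B \<in> L" for g A B
    unfolding rlen_slen using serre_relation.slen_perspective[OF less[OF that(1)]] that by blast
  \<comment> \<open>An interval of finite length at \<open>g\<close> is small at every larger
    \<open>h\<close>, so its length there is even 0.\<close>
  have mono: "rlen L h A B < \<infinity>"
    if "g \<le> h" "h < a" "A \<in> L" "B \<in> L" "A \<subseteq> B" "rlen L g A B < \<infinity>" for g h A B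
  proof (cases "g = h")
    case False
    then have "small L h A B" using that by (auto simp: small_def)
    then have "rlen L h A B = 0"
      unfolding rlen_slen using serre_relation.slen_eq_0_iff[OF less[OF that(2)]] that by blast
    then show ?thesis by simp
  qed (use that in simp)
  show ?case
  proof
    show "small L a A A" for A by (simp add: small_def)
  next
    fix A B C assume L: "A \<in> L" "B \<in> L" "C \<in> L" "A \<subseteq> B" "B \<subseteq> C"
    show "small L a A C \<longleftrightarrow> small L a A B \<and> small L a B C"
    proof
      assume AC: "small L a A C"
      show "small L a A B \<and> small L a B C"
      proof (cases "A = C")
        case False
        then obtain g where "g < a" "rlen L g A C < \<infinity>" using AC unfolding small_def by blast
        then have "rlen L g A B < \<infinity> \<and> rlen L g B C < \<infinity>"
          using add[of g A B C] L by (metis enat_add_less_infinity_iff)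
        then show ?thesis using \<open>g < a\<close> unfolding small_def by blast
      qed (use L in \<open>auto simp: small_def\<close>)
    next
      assume *: "small L a A B \<and> small L a B C"
      show "small L a A C"
      proof (cases "A = B \<or> B = C")
        case False
        then obtain g h where gh: "g < a" "rlen L g A B < \<infinity>" "h < a" "rlen L h B C < \<infinity>"
          using * unfolding small_def by blast
        \<comment> \<open>Both parts have finite length at the larger of the two levels, where
          additivity joins them.\<close>
        have m: "max g h < a" using gh by simp
        have "rlen L (max g h) A B < \<infinity>" "rlen L (max g h) B C < \<infinity>"
          using mono[OF _ m] gh L by (meson max.cobounded1 max.cobounded2)+
        then have "rlen L (max g h) A C < \<infinity>"
          using add[OF m L] by (simp only: enat_add_less_infinity_iff)
        then show ?thesis using m unfolding small_def by blast
      qed (use * in auto)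
    qed
  next
    fix A B assume L: "A \<in> L" "B \<in> L"
    \<comment> \<open>This matches the trivial disjunct of \<open>small\<close>; the other one is
      perspectivity of \<open>rlen\<close> at lower levels.\<close>
    have "A \<inter> B = A \<longleftrightarrow> B = J A B"
      using J_absorb1[OF L] J_ub1[OF L] by blast
    then show "small L a (A \<inter> B) A \<longleftrightarrow> small L a B (J A B)"
      unfolding small_def using persp L by metis
  qed
qed

lemma rlen_add:
  "A \<in> L \<Longrightarrow> B \<in> L \<Longrightarrow> C \<in> L \<Longrightarrow> A \<subseteq> B \<Longrightarrow> B \<subseteq> C \<Longrightarrow> rlen L a A C = rlen L a A B + rlen L a B C"
  unfolding rlen_slen by (rule serre_relation.slen_add[OF serre_small])

lemma rlen_eq_0_iff:
  "A \<in> L \<Longrightarrow> B \<in> L \<Longrightarrow> A \<subseteq> B \<Longrightarrow> rlen L a A B = 0 \<longleftrightarrow> small L a A B"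
  unfolding rlen_slen by (rule serre_relation.slen_eq_0_iff[OF serre_small])

lemma rlen_perspective:
  "A \<in> L \<Longrightarrow> B \<in> L \<Longrightarrow> rlen L a (A \<inter> B) A = rlen L a B (J A B)"
  unfolding rlen_slen by (rule serre_relation.slen_perspective[OF serre_small])

lemma rlen_refl [simp]: "A \<in> L \<Longrightarrow> rlen L a A A = 0"
  by (simp add: rlen_eq_0_iff small_def)

lemma rlen_mono:
  assumes "A \<in> L" "A' \<in> L" "B' \<in> L" "B \<in> L" "A \<subseteq> A'" "A' \<subseteq> B'" "B' \<subseteq> B"
  shows "rlen L a A' B' \<le> rlen L a A B"
proof -
  have "rlen L a A B = rlen L a A A' + (rlen L a A' B' + rlen L a B' B)"
    using assms rlen_add[of A A' B a] rlen_add[of A' B' B a] order_trans[of A' B' B] by simp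
  then show ?thesis
    by (metis add.assoc add.commute le_iff_add)
qed

lemma rlen_eq_0_above:
  "A \<in> L \<Longrightarrow> B \<in> L \<Longrightarrow> A \<subseteq> B \<Longrightarrow> rlen L a A B < \<infinity> \<Longrightarrow> a < b \<Longrightarrow> rlen L b A B = 0"
  by (auto simp: rlen_eq_0_iff small_def)

text \<open>With two counted steps, the first proper step would leave an interval
  \<open>[C, B]\<close> that still counts one step and so is not small.\<close>

lemma rlen_le_1:
  assumes "A \<in> L" "B \<in> L" "A \<subseteq> B"
    and "\<And>C. C \<in> L \<Longrightarrow> A \<subset> C \<Longrightarrow> C \<subseteq> B \<Longrightarrow> small L a C B"
  shows "rlen L a A B \<le> 1"
proof (rule ccontr)
  assume "\<not> ?thesis"
  then have "enat (Suc 1) \<le> rlen L a A B"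
    by (metis Suc_ile_eq not_le one_enat_def)
  then have "steps L (small L a) A B (Suc 1)"
    unfolding rlen_slen le_slen_steps[OF assms(1-3)] .
  from steps_first_proper[OF _ this]
  obtain C where C: "C \<in> L" "A \<subset> C" "C \<subseteq> B" "steps L (small L a) C B 1"
    by (auto simp: small_def)
  from steps_le_slen[OF C(4)] have "rlen L a C B \<noteq> 0"
    by (auto simp: rlen_slen zero_enat_def)
  then show False using rlen_eq_0_iff[of C B a] C assms by blast
qed

text \<open>Noetherian induction from above: for every larger \<open>C\<close> the interval
  \<open>[C, B]\<close> is finite at level \<open>r C\<close>, hence small at level
  \<open>r A\<close>, so \<open>rlen_le_1\<close> applies.\<close>

lemma ex_rlen_finite:
  fixes r :: "'b set \<Rightarrow> 'i::wellorder"
  assumes r: "\<And>A B. A \<in> L \<Longrightarrow> B \<in> L \<Longrightarrow> A \<subset> B \<Longrightarrow> r B < r A"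
    and "A \<in> L" "B \<in> L" "A \<subseteq> B"
  shows "rlen L (r A) A B < \<infinity>"
  using assms(2-)
proof (induction A rule: wf_induct_rule[OF acc])
  case (1 A)
  have "rlen L (r A) A B \<le> 1"
  proof (rule rlen_le_1)
    fix C assume C: "C \<in> L" "A \<subset> C" "C \<subseteq> B"
    then have "rlen L (r C) C B < \<infinity>" "r C < r A"
      using 1 r by auto
    then show "small L (r A) C B" unfolding small_def by blast
  qed (use 1 in auto)
  then show ?case
    by (metis enat_ord_code(4) one_enat_def order_le_less_trans)
qed

text \<open>A maximal \<open>T\<close> of finite length exists by the chain condition. It is
  greatest because additivity and perspectivity make finite length stable under joins.\<close>

lemma greatest_finite_exists:
  assumes "A \<in> L" "B \<in> L" "A \<subseteq> B"
  shows "\<exists>T. T \<in> L \<and> A \<subseteq> T \<and> T \<subseteq> B \<and> rlen L a A T < \<infinity> \<and>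
    (\<forall>T'\<in>L. A \<subseteq> T' \<longrightarrow> T' \<subseteq> B \<longrightarrow> rlen L a A T' < \<infinity> \<longrightarrow> T' \<subseteq> T)"
proof -
  let ?S = "{T\<in>L. A \<subseteq> T \<and> T \<subseteq> B \<and> rlen L a A T < \<infinity>}"
  have "A \<in> ?S" using assms by simp
  then obtain T where T: "T \<in> ?S" "\<And>T'. T' \<in> ?S \<Longrightarrow> \<not> T \<subset> T'"
    using maximal_element[of ?S] by blast
  have "T' \<subseteq> T" if T': "T' \<in> ?S" for T'
  proof -
    have "rlen L a A (J T' T) = rlen L a A T + rlen L a T (J T' T)"
      using T(1) T' assms by (intro rlen_add) (auto simp: J_ub2)
    moreover have "rlen L a T (J T' T) = rlen L a (T' \<inter> T) T'"
      using T(1) T' by (simp add: rlen_perspective)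
    moreover have "rlen L a (T' \<inter> T) T' \<le> rlen L a A T'"
      using T(1) T' assms by (intro rlen_mono) auto
    ultimately have "rlen L a A (J T' T) < \<infinity>"
      using T(1) T' by (metis (no_types, lifting) enat_add_less_infinity_iff mem_Collect_eq order_le_less_trans)
    then have "J T' T \<in> ?S"
      using T(1) T' assms J_ub2[of T' T] J_least[of T' T B] by auto
    then have "J T' T = T" using T J_ub2[of T' T] T' by blast
    then show ?thesis using J_ub1[of T' T] T T' by auto
  qed
  then show ?thesis using T by blast
qed

end

text \<open>
  \<open>coef L A B a\<close> is the coefficient of \<open>\<omega>\<^sup>a\<close> in the Cantor normal form of the ordinal length of the
  interval \<open>[A, B]\<close>.
\<close>

definition finpart :: "'b set set \<Rightarrow> 'i::wellorder \<Rightarrow> 'b set \<Rightarrow> 'b set \<Rightarrow> 'b set" where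
  "finpart L a A B = (SOME T. T \<in> L \<and> A \<subseteq> T \<and> T \<subseteq> B \<and> rlen L a A T < \<infinity> \<and>
    (\<forall>T'\<in>L. A \<subseteq> T' \<longrightarrow> T' \<subseteq> B \<longrightarrow> rlen L a A T' < \<infinity> \<longrightarrow> T' \<subseteq> T))"

definition coef :: "'b set set \<Rightarrow> 'b set \<Rightarrow> 'b set \<Rightarrow> 'i::wellorder \<Rightarrow> enat" where
  "coef L A B a = rlen L a A (finpart L a A B)"

definition lex_less :: "('i::wellorder \<Rightarrow> enat) \<Rightarrow> ('i \<Rightarrow> enat) \<Rightarrow> bool" where
  "lex_less f g \<longleftrightarrow> (\<exists>a. f a < g a \<and> (\<forall>b>a. f b = g b))"

lemma lex_less_trans: "lex_less f g \<Longrightarrow> lex_less g h \<Longrightarrow> lex_less f h"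
proof -
  assume "lex_less f g" "lex_less g h"
  then obtain a b where a: "f a < g a" "\<forall>c>a. f c = g c" and b: "g b < h b" "\<forall>c>b. g c = h c"
    by (auto simp: lex_less_def)
  have "f (max a b) < h (max a b)"
    using a b by (cases a b rule: linorder_cases) (auto simp: max_def intro: order_less_trans)
  then show ?thesis using a b unfolding lex_less_def by (intro exI[of _ "max a b"]) auto
qed

section \<open>Greatest parts of finite length and coefficients\<close>

context noetherian_modular
begin

lemma finpart:
  assumes "A \<in> L" "B \<in> L" "A \<subseteq> B"
  shows finpart_in [simp]: "finpart L a A B \<in> L"
    and finpart_lower: "A \<subseteq> finpart L a A B"
    and finpart_upper: "finpart L a A B \<subseteq> B"
    and finpart_finite: "rlen L a A (finpart L a A B) < \<infinity>"
    and finpart_greatest: "T \<in> L \<Longrightarrow> A \<subseteq> T \<Longrightarrow> T \<subseteq> B \<Longrightarrow> rlen L a A T < \<infinity> \<Longrightarrow> T \<subseteq> finpart L a A B"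
  using someI_ex[OF greatest_finite_exists[OF assms, of a], folded finpart_def] by blast+

lemma finpart_eqI:
  assumes "A \<in> L" "B \<in> L" "A \<subseteq> B"
    and "T \<in> L" "A \<subseteq> T" "T \<subseteq> B" "rlen L a A T < \<infinity>"
    and "\<And>T'. T' \<in> L \<Longrightarrow> A \<subseteq> T' \<Longrightarrow> T' \<subseteq> B \<Longrightarrow> rlen L a A T' < \<infinity> \<Longrightarrow> T' \<subseteq> T"
  shows "finpart L a A B = T"
proof (rule subset_antisym)
  note f = finpart[OF assms(1-3), where a = a]
  show "finpart L a A B \<subseteq> T" by (rule assms(8)[OF f(1-4)])
  show "T \<subseteq> finpart L a A B" by (rule f(5)[OF assms(4-7)])
qed

text \<open>If \<open>[A, A']\<close> has finite length, then for \<open>T\<close> above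
  \<open>A'\<close> the intervals \<open>[A, T]\<close> and \<open>[A', T]\<close> are finite
  together, so they have the same greatest candidate.\<close>

lemma finpart_lower_change:
  assumes "A \<in> L" "A' \<in> L" "B \<in> L" "A \<subseteq> A'" "A' \<subseteq> B" "rlen L a A A' < \<infinity>"
  shows "finpart L a A' B = finpart L a A B"
proof (rule finpart_eqI)
  have AB: "A \<subseteq> B" using assms by blast
  note f = finpart[OF assms(1,3) AB, where a = a]
  show A': "A' \<subseteq> finpart L a A B" by (rule f(5)) (use assms in auto)
  show "rlen L a A' (finpart L a A B) < \<infinity>"
    by (rule order_le_less_trans[OF rlen_mono f(4)]) (use f(1,2) assms A' in simp_all)
  fix T' assume T': "T' \<in> L" "A' \<subseteq> T'" "T' \<subseteq> B" "rlen L a A' T' < \<infinity>"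
  then have "rlen L a A T' < \<infinity>" using rlen_add[of A A' T' a] assms
    by (metis enat_add_less_infinity_iff)
  then show "T' \<subseteq> finpart L a A B"
    using T' assms by (intro f(5)) auto
qed (use assms finpart[OF assms(1,3), where a = a] in auto)

lemma coef_lower_change:
  assumes "A \<in> L" "A' \<in> L" "B \<in> L" "A \<subseteq> A'" "A' \<subseteq> B" "rlen L a A A' < \<infinity>"
  shows "coef L A B a = rlen L a A A' + coef L A' B a"
  unfolding coef_def finpart_lower_change[OF assms]
  using assms finpart[where A = A and B = B and a = a] by (intro rlen_add) auto

lemma coef_finite: "A \<in> L \<Longrightarrow> B \<in> L \<Longrightarrow> A \<subseteq> B \<Longrightarrow> coef L A B a < \<infinity>"
  unfolding coef_def by (rule finpart_finite)

lemma rlen_le_coef: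
  assumes "A \<in> L" "B \<in> L" "T \<in> L" "A \<subseteq> T" "T \<subseteq> B" "rlen L a A T < \<infinity>"
  shows "rlen L a A T \<le> coef L A B a"
  unfolding coef_def using assms finpart[where A = A and B = B and a = a] by (intro rlen_mono) auto

text \<open>Take a maximal \<open>T\<close> among the finite parts at levels in \<open>S\<close>,
  say at level \<open>a\<close>. At a larger level \<open>b\<close> it has length 0, so it lies in
  the finite part there and equals it, which makes the coefficient at \<open>b\<close> vanish. As
  levels are well-ordered, the statement says that the support is finite.\<close>

lemma coef_support_max:
  fixes S :: "'i::wellorder set"
  assumes "A \<in> L" "B \<in> L" "A \<subseteq> B" and "S \<noteq> {}" and S: "\<And>a. a \<in> S \<Longrightarrow> coef L A B a \<noteq> 0"
  shows "\<exists>a\<in>S. \<forall>b\<in>S. b \<le> a"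
proof -
  let ?F = "(\<lambda>a. finpart L a A B) ` S"
  have "?F \<subseteq> L" "?F \<noteq> {}" using assms finpart by auto
  then obtain T where T: "T \<in> ?F" "\<And>T'. T' \<in> ?F \<Longrightarrow> \<not> T \<subset> T'"
    using maximal_element by blast
  then obtain a where a: "a \<in> S" "T = finpart L a A B" by blast
  have "b \<le> a" if b: "b \<in> S" for b
  proof (rule ccontr)
    assume "\<not> b \<le> a"
    then have "a < b" by simp
    then have *: "rlen L b A T = 0"
      unfolding a(2) using assms finpart[where A = A and B = B and a = a] by (intro rlen_eq_0_above) auto
    then have "T \<subseteq> finpart L b A B"
      using * unfolding a(2) by (intro finpart_greatest) (simp_all add: assms finpart)
    then have "T = finpart L b A B" using T b by blast
    then show False using S[OF b] * by (simp add: coef_def)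
  qed
  then show ?thesis using a by blast
qed

end

section \<open>Lexicographic comparison of heights\<close>

text \<open>If \<open>f\<close> and \<open>g\<close> agree at \<open>a\<close>, the first difference
  lies below \<open>a\<close>. The level \<open>c\<close> of the last hypothesis need not be the
  decisive one, as \<open>g\<close> may be nonzero between \<open>c\<close> and \<open>a\<close>;
  \<open>supp\<close> selects the largest suitable level.\<close>

lemma lex_less_or_eqI:
  fixes f g :: "'i::wellorder \<Rightarrow> enat"
  assumes above: "\<And>b. a < b \<Longrightarrow> f b = g b" and "f a \<le> g a"
    and supp: "\<And>S. S \<noteq> {} \<Longrightarrow> (\<And>b. b \<in> S \<Longrightarrow> g b \<noteq> 0) \<Longrightarrow> \<exists>c\<in>S. \<forall>b\<in>S. b \<le> c"
    and below: "(\<forall>b<a. f b = 0) \<or> (\<exists>c<a. f c < g c \<and> (\<forall>b. c < b \<longrightarrow> b < a \<longrightarrow> f b = 0))"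
  shows "f = g \<or> lex_less f g"
proof (cases "f a < g a")
  case True
  then show ?thesis using above by (auto simp: lex_less_def)
next
  case False
  then have eq: "f b = g b" if "a \<le> b" for b
    using \<open>f a \<le> g a\<close> above that by (cases "a = b") auto
  define S where "S = {b. b < a \<and> g b \<noteq> 0 \<and> f b < g b \<and> (\<forall>d. b < d \<longrightarrow> d < a \<longrightarrow> f d = 0)}"
  show ?thesis
  proof (cases "S = {}")
    case True
    then have f0: "f b = 0" if "b < a" for b
      using below that by (force simp: S_def)
    then have "g b = 0" if "b < a" for b
      using True that by (auto simp: S_def zero_less_iff_neq_zero)
    then have "f = g"
      using f0 eq by (metis ext not_le)
    then show ?thesis ..
  next
    case False
    obtain c where c: "c \<in> S" "\<And>b. b \<in> S \<Longrightarrow> b \<le> c"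
      using supp[OF False] by (auto simp: S_def)
    have "f b = g b" if "c < b" for b
    proof (cases "a \<le> b")
      case False
      then have "f b = 0" "\<forall>d. b < d \<longrightarrow> d < a \<longrightarrow> f d = 0" using c(1) that by (auto simp: S_def)
      moreover have "b \<notin> S" using c(2) that by force
      ultimately show ?thesis using False by (auto simp: S_def zero_less_iff_neq_zero)
    qed (rule eq)
    then show ?thesis using c(1) by (auto simp: S_def lex_less_def)
  qed
qed

section \<open>Interpolation between coefficient sequences\<close>

lemma enat_less_one_plus: "x < 1 + (y::enat) \<Longrightarrow> x \<le> y"
  by (cases x; cases y) (auto simp: one_enat_def)

text \<open>The rank guarantees enough levels: by \<open>ex_rlen_finite\<close> every interval has
  finite length at some level.\<close>

locale ranked_modular = noetherian_modular L J
  for L :: "'b set set" and J +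
  fixes r :: "'b set \<Rightarrow> 'i::wellorder"
  assumes r_strict: "A \<in> L \<Longrightarrow> B \<in> L \<Longrightarrow> A \<subset> B \<Longrightarrow> r B < r A"
begin

text \<open>Length 0 at the least finite level would make the nontrivial interval small there, hence
  finite at a still lower level.\<close>

lemma least_finite_level:
  assumes "A \<in> L" "B \<in> L" "A \<subset> B"
  obtains a :: 'i where "rlen L a A B < \<infinity>" "rlen L a A B \<noteq> 0" "\<And>b. rlen L b A B < \<infinity> \<Longrightarrow> a \<le> b"
proof
  let ?a = "LEAST a :: 'i. rlen L a A B < \<infinity>"
  have "rlen L (r A) A B < \<infinity>"
    by (rule ex_rlen_finite) (use assms r_strict in auto)
  then show fin: "rlen L ?a A B < \<infinity>" by (rule LeastI)
  show le: "?a \<le> b" if "rlen L b A B < \<infinity>" for b using that by (rule Least_le)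
  have "\<not> small L ?a A B" using le assms unfolding small_def by (metis leD psubset_eq)
  then show "rlen L ?a A B \<noteq> 0" using assms by (simp add: rlen_eq_0_iff)
qed

text \<open>The least finite level of \<open>[A, A']\<close> decides: the coefficient drops there by
  the nonzero length of \<open>[A, A']\<close>, and at higher levels that length is 0.\<close>

lemma coef_lex_less:
  assumes "A \<in> L" "A' \<in> L" "B \<in> L" "A \<subset> A'" "A' \<subseteq> B"
  shows "lex_less (coef L A' B :: 'i \<Rightarrow> enat) (coef L A B)"
proof -
  obtain a :: 'i where a: "rlen L a A A' < \<infinity>" "rlen L a A A' \<noteq> 0"
    using least_finite_level[OF assms(1,2,4)] by metis
  have le: "A \<subseteq> A'" using assms by blast
  have "coef L A B a = rlen L a A A' + coef L A' B a"
    using assms a le by (intro coef_lower_change) auto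
  moreover have "coef L A' B a < \<infinity>" using assms by (intro coef_finite) auto
  ultimately have "coef L A' B a < coef L A B a"
    using a(2) by (cases "coef L A' B a"; cases "rlen L a A A'") (auto simp: zero_enat_def)
  moreover have "coef L A' B b = coef L A B b" if "a < b" for b
    using assms le rlen_eq_0_above[OF _ _ le a(1) that] coef_lower_change[of A A' B b] by auto
  ultimately show ?thesis unfolding lex_less_def by blast
qed

text \<open>Choose \<open>D\<close> with the least nonzero length. If \<open>[A, D]\<close> had two
  counted steps, the upper end of the first would have a smaller nonzero length over
  \<open>A\<close>.\<close>

lemma simple_subinterval:
  assumes "A \<in> L" "T \<in> L" "A \<subseteq> T" "rlen L a A T < \<infinity>" "rlen L a A T \<noteq> 0"
  obtains D where "D \<in> L" "A \<subseteq> D" "D \<subseteq> T" "rlen L a A D = 1"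
proof -
  let ?P = "\<lambda>v. v \<noteq> 0 \<and> (\<exists>D\<in>L. A \<subseteq> D \<and> D \<subseteq> T \<and> rlen L a A D = v)"
  define v where "v = (LEAST v. ?P v)"
  have "?P (rlen L a A T)" using assms by blast
  then have "?P v" unfolding v_def by (rule LeastI)
  then obtain D where D: "v \<noteq> 0" "D \<in> L" "A \<subseteq> D" "D \<subseteq> T" "rlen L a A D = v" by blast
  have "v \<le> rlen L a A T"
    unfolding D(5)[symmetric] using assms D by (intro rlen_mono) auto
  have "v = 1"
  proof (rule ccontr)
    assume "v \<noteq> 1"
    then have "enat (Suc 1) \<le> v" using D(1)
      by (cases v) (auto simp: one_enat_def zero_enat_def)
    then have "steps L (small L a) A D (Suc 1)"
      unfolding D(5)[symmetric] rlen_slen le_slen_steps[OF assms(1) D(2,3)] .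
    then obtain C C' where C: "C \<in> L" "C' \<in> L" "A \<subseteq> C" "C \<subseteq> C'" "\<not> small L a C C'"
      and st: "steps L (small L a) C' D 1"
      by (meson steps_first_step)
    have C'D: "C' \<subseteq> D" using steps_in[OF st] by blast
    have "rlen L a C C' \<noteq> 0" using C by (simp add: rlen_eq_0_iff)
    moreover have "rlen L a C C' \<le> rlen L a A C'" using C assms(1) by (intro rlen_mono) auto
    ultimately have nz: "rlen L a A C' \<noteq> 0" by auto
    have nz': "rlen L a C' D \<noteq> 0"
      using steps_le_slen[OF st] by (auto simp: rlen_slen zero_enat_def)
    have "v = rlen L a A C' + rlen L a C' D"
      unfolding D(5)[symmetric] using C C'D D assms by (intro rlen_add) auto
    then have "rlen L a A C' < v"
      using nz nz' \<open>v \<le> rlen L a A T\<close> assms(4)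
      by (cases "rlen L a A C'"; cases "rlen L a C' D") (auto simp: zero_enat_def)
    moreover have "?P (rlen L a A C')" using nz C C'D D by blast
    ultimately show False unfolding v_def using not_less_Least by blast
  qed
  then show ?thesis using that D by blast
qed

text \<open>
  Once the part of \<open>[A, D]\<close> that is small at level \<open>a\<close> is divided out, every proper step has length
  one at level \<open>a\<close>, while the length at level \<open>c\<close> is still infinite. So arbitrarily long chains at
  level \<open>c\<close> remain above the first proper step. If the length at level \<open>c\<close> above that step is
  itself infinite, the witness \<open>d\<close> is the least level at which it becomes finite.
\<close>

lemma large_lower_coefficient:
  fixes a :: 'i
  assumes "A \<in> L" "B \<in> L" "D \<in> L" "A \<subseteq> D" "D \<subseteq> B" "rlen L a A D = 1" "c < a"
  obtains A' d where "A' \<in> L" "A \<subset> A'" "A' \<subseteq> D" "rlen L a A A' = 1" "c \<le> d" "d < a"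
    "coef L A' B d \<noteq> 0" "d = c \<Longrightarrow> enat n < coef L A' B d"
proof -
  interpret Z: serre_relation L J "small L a" by (rule serre_small)
  let ?S = "{C\<in>L. A \<subseteq> C \<and> C \<subseteq> D \<and> small L a A C}"
  have "A \<in> ?S" using assms by (simp add: small_def)
  then obtain C where C: "C \<in> ?S" "\<And>C'. C' \<in> ?S \<Longrightarrow> \<not> C \<subset> C'"
    using maximal_element[of ?S] by blast
  have nsmall: "\<not> small L a A D" using assms rlen_eq_0_iff[of A D a] by simp
  have "rlen L c C D = \<infinity>"
  proof (rule ccontr)
    assume "rlen L c C D \<noteq> \<infinity>"
    then have "small L a C D" using assms(7) by (auto simp: small_def)
    then have "small L a A D" using Z.Z_trans[of A C D] C(1) assms by blast
    then show False using nsmall by blast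
  qed
  \<comment> \<open>One step is used up by the first proper link above \<open>C\<close>; the other
    makes \<open>n\<close> strictly smaller than the remaining length.\<close>
  then have "enat (Suc (Suc n)) \<le> slen L (small L c) C D" by (simp add: rlen_slen)
  then have "steps L (small L c) C D (Suc (Suc n))"
    using C(1) assms by (simp add: le_slen_steps)
  from steps_first_proper[OF _ this] obtain A' where
    A': "A' \<in> L" "C \<subset> A'" "A' \<subseteq> D" "steps L (small L c) A' D (Suc n)"
    by (auto simp: small_def)
  have AA': "A \<subset> A'" using A' C by blast
  have big: "enat (Suc n) \<le> rlen L c A' D"
    using steps_le_slen[OF A'(4)] by (simp add: rlen_slen)
  have "\<not> small L a A A'" using C A' AA' by blast
  then have "rlen L a A A' \<noteq> 0" using rlen_eq_0_iff[of A A' a] A' AA' assms by blast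
  moreover have "1 = rlen L a A A' + rlen L a A' D"
    unfolding assms(6)[symmetric] using AA' A' assms by (intro rlen_add) auto
  \<comment> \<open>The total is 1 and the first summand is nonzero, so the remainder
    \<open>[A', D]\<close> is small at level \<open>a\<close>.\<close>
  ultimately have 1: "rlen L a A A' = 1" and 0: "rlen L a A' D = 0"
    by (cases "rlen L a A A'"; cases "rlen L a A' D"; simp add: one_enat_def zero_enat_def)+
  have ne: "A' \<noteq> D"
  proof
    assume "A' = D"
    then show False using big A' by (simp add: zero_enat_def)
  qed
  then obtain d :: 'i where d: "rlen L d A' D < \<infinity>" "rlen L d A' D \<noteq> 0"
      "\<And>b. rlen L b A' D < \<infinity> \<Longrightarrow> d \<le> b"
    using least_finite_level[of A' D] A' assms by blast
  have A'B: "A' \<subseteq> B" using A' assms by blast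
  have coef_d: "rlen L d A' D \<le> coef L A' B d"
    using d A' assms A'B by (intro rlen_le_coef) auto
  have "small L a A' D" using 0 A' assms by (simp add: rlen_eq_0_iff)
  then obtain b where "b < a" "rlen L b A' D < \<infinity>" using ne unfolding small_def by blast
  then have "d < a" using d(3) by force
  moreover have "c \<le> d"
  proof (rule ccontr)
    assume "\<not> c \<le> d"
    then have "rlen L c A' D = 0" using d A' assms by (intro rlen_eq_0_above[of _ _ d]) auto
    then show False using big by (simp add: zero_enat_def)
  qed
  moreover have "coef L A' B d \<noteq> 0" using coef_d d(2) by auto
  moreover have "enat n < coef L A' B d" if "d = c"
    using big coef_d that by (meson Suc_ile_eq order_trans)
  ultimately show ?thesis using that A' AA' 1 by blast
qed

text \<open>One unit of the coefficient at the decisive level \<open>a\<close> is given up by moving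
  into an interval \<open>[A, D]\<close> of length 1. If \<open>f\<close> is nonzero somewhere below
  \<open>a\<close>, the new lower end is chosen inside \<open>D\<close> so that its coefficients
  below \<open>a\<close> beat those of \<open>f\<close>.\<close>

lemma coef_interpolation:
  fixes f :: "'i \<Rightarrow> enat"
  assumes AB: "A \<in> L" "B \<in> L" "A \<subseteq> B" and fin: "\<And>a. f a < \<infinity>"
    and supp: "\<And>S. S \<noteq> {} \<Longrightarrow> (\<And>b. b \<in> S \<Longrightarrow> f b \<noteq> 0) \<Longrightarrow> \<exists>c\<in>S. \<forall>b\<in>S. b \<le> c"
    and less: "lex_less f (coef L A B)"
  obtains A' where "A' \<in> L" "A \<subset> A'" "A' \<subseteq> B" "f = coef L A' B \<or> lex_less f (coef L A' B)"
proof -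
  obtain a where a: "f a < coef L A B a" "\<And>b. a < b \<Longrightarrow> f b = coef L A B b"
    using less by (auto simp: lex_less_def)
  note t = finpart[OF AB, where a = a]
  have "rlen L a A (finpart L a A B) \<noteq> 0" using a(1) by (auto simp: coef_def)
  from simple_subinterval[OF AB(1) t(1,2,4) this] obtain D where
    D: "D \<in> L" "A \<subseteq> D" "D \<subseteq> finpart L a A B" "rlen L a A D = 1" by blast
  have DB: "D \<subseteq> B" using D t by blast
  have "\<exists>A'\<in>L. A \<subset> A' \<and> A' \<subseteq> D \<and> rlen L a A A' = 1 \<and>
    ((\<forall>b<a. f b = 0) \<or> (\<exists>c<a. f c < coef L A' B c \<and> (\<forall>b. c < b \<longrightarrow> b < a \<longrightarrow> f b = 0)))"
  proof (cases "\<forall>b<a. f b = 0")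
    case True
    have "A \<noteq> D" using D by auto
    then show ?thesis using True D by (intro bexI[of _ D]) auto
  next
    case False
    \<comment> \<open>Below \<open>a\<close>, the leading nonzero value of \<open>f\<close> is at
      \<open>c\<close>. It is beaten either by a coefficient larger than \<open>f c\<close> at
      \<open>c\<close> or by any nonzero coefficient between \<open>c\<close> and
      \<open>a\<close>.\<close>
    then obtain c where c: "c < a" "f c \<noteq> 0" "\<And>b. b < a \<Longrightarrow> f b \<noteq> 0 \<Longrightarrow> b \<le> c"
      using supp[of "{b. b < a \<and> f b \<noteq> 0}"] by blast
    obtain n where n: "f c = enat n" using fin[of c] by (cases "f c") auto
    obtain A' d where A': "A' \<in> L" "A \<subset> A'" "A' \<subseteq> D" "rlen L a A A' = 1" "c \<le> d" "d < a"
      "coef L A' B d \<noteq> 0" "d = c \<Longrightarrow> enat n < coef L A' B d"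
      using large_lower_coefficient[OF AB(1,2) D(1,2) DB D(4) c(1)] by metis
    have f0: "f b = 0" if "c < b" "b < a" for b using c(3)[of b] that by force
    have "f d < coef L A' B d"
    proof (cases "d = c")
      case False
      then have "f d = 0" using A' f0 by auto
      then show ?thesis using A' by (simp add: zero_less_iff_neq_zero)
    qed (use A' n in simp)
    then show ?thesis using A' f0 by (intro bexI[of _ A']) (auto intro!: exI[of _ d])
  qed
  then obtain A' where A': "A' \<in> L" "A \<subset> A'" "A' \<subseteq> D" "rlen L a A A' = 1"
    and below: "(\<forall>b<a. f b = 0) \<or> (\<exists>c<a. f c < coef L A' B c \<and> (\<forall>b. c < b \<longrightarrow> b < a \<longrightarrow> f b = 0))"
    by blast
  have A'B: "A' \<subseteq> B" and le: "A \<subseteq> A'" using A' DB by auto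
  have fin1: "rlen L a A A' < \<infinity>" using A'(4) by simp
  \<comment> \<open>Exactly one unit is lost at level \<open>a\<close>, so the strict inequality for
    \<open>f a\<close> weakens to a non-strict one.\<close>
  have "coef L A B a = 1 + coef L A' B a"
    using coef_lower_change[OF AB(1) A'(1) AB(2) le A'B fin1] A'(4) by simp
  then have 1: "f a \<le> coef L A' B a" using a(1) by (metis enat_less_one_plus)
  have 2: "f b = coef L A' B b" if "a < b" for b
    using a(2)[OF that] rlen_eq_0_above[OF AB(1) A'(1) le fin1 that]
      coef_lower_change[OF AB(1) A'(1) AB(2) le A'B, of b] by simp
  have "f = coef L A' B \<or> lex_less f (coef L A' B)"
  proof (rule lex_less_or_eqI[of a, OF 2 1 _ below])
    show "\<exists>c\<in>S. \<forall>b\<in>S. b \<le> c"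
      if "S \<noteq> {}" "\<And>b. b \<in> S \<Longrightarrow> coef L A' B b \<noteq> 0" for S :: "'i set"
      by (rule coef_support_max[OF A'(1) AB(2) A'B that])
  qed
  with A' A'B show ?thesis by (intro that) auto
qed

end

text \<open>The two axioms say that \<open>h A B\<close> is the least strict upper bound of the
  \<open>h A' B\<close> with \<open>A \<subset> A' \<subseteq> B\<close>; this is the recursion of
  the ordinal height.\<close>

locale height_modular = ranked_modular L J r
  for L :: "'b set set" and J and r :: "'b set \<Rightarrow> 'i::wellorder" +
  fixes h :: "'b set \<Rightarrow> 'b set \<Rightarrow> 'o::linorder"
  assumes h_strict: "A \<in> L \<Longrightarrow> A' \<in> L \<Longrightarrow> B \<in> L \<Longrightarrow> A \<subset> A' \<Longrightarrow> A' \<subseteq> B \<Longrightarrow> h A' B < h A B"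
    and h_least: "A \<in> L \<Longrightarrow> B \<in> L \<Longrightarrow> A \<subseteq> B \<Longrightarrow>
      (\<And>A'. A' \<in> L \<Longrightarrow> A \<subset> A' \<Longrightarrow> A' \<subseteq> B \<Longrightarrow> h A' B < x) \<Longrightarrow> h A B \<le> x"
begin

lemma interpolate:
  assumes "A \<in> L" "B \<in> L" "A \<subseteq> B" "C \<in> L" "D \<in> L" "C \<subseteq> D"
    and "lex_less (coef L A B :: 'i \<Rightarrow> enat) (coef L C D)"
  obtains C' where "C' \<in> L" "C \<subset> C'" "C' \<subseteq> D"
    "(coef L A B :: 'i \<Rightarrow> enat) = coef L C' D \<or> lex_less (coef L A B :: 'i \<Rightarrow> enat) (coef L C' D)"
proof (rule coef_interpolation[OF assms(4-6) _ _ assms(7)])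
  show "coef L A B a < \<infinity>" for a :: 'i by (rule coef_finite[OF assms(1-3)])
  show "\<exists>c\<in>S. \<forall>b\<in>S. b \<le> c"
    if "S \<noteq> {}" "\<And>b. b \<in> S \<Longrightarrow> coef L A B b \<noteq> 0" for S :: "'i set"
    by (rule coef_support_max[OF assms(1-3) that])
qed (rule that)

text \<open>Enlarging \<open>A\<close> to \<open>A'\<close> lowers the coefficients strictly, and
  interpolation finds a matching enlargement \<open>C'\<close> of \<open>C\<close>. By induction
  \<open>h A' B \<le> h C' D < h C D\<close>, so \<open>h_least\<close> gives the bound.\<close>

lemma h_mono:
  assumes "A \<in> L" "B \<in> L" "A \<subseteq> B" "C \<in> L" "D \<in> L" "C \<subseteq> D"
    and "(coef L A B :: 'i \<Rightarrow> enat) = coef L C D \<or> lex_less (coef L A B :: 'i \<Rightarrow> enat) (coef L C D)"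
  shows "h A B \<le> h C D"
  using assms
proof (induction A arbitrary: C rule: wf_induct_rule[OF acc])
  case (1 A C)
  show ?case
  proof (rule h_least)
    fix A' assume A': "A' \<in> L" "A \<subset> A'" "A' \<subseteq> B"
    have "lex_less (coef L A' B :: 'i \<Rightarrow> enat) (coef L A B)"
      using A' 1 by (intro coef_lex_less) auto
    then have "lex_less (coef L A' B :: 'i \<Rightarrow> enat) (coef L C D)"
      using 1(8) lex_less_trans by metis
    then obtain C' where C': "C' \<in> L" "C \<subset> C'" "C' \<subseteq> D"
      "(coef L A' B :: 'i \<Rightarrow> enat) = coef L C' D \<or> lex_less (coef L A' B :: 'i \<Rightarrow> enat) (coef L C' D)"
      using interpolate[of A' B C D] A' 1 by metis
    then have "h A' B \<le> h C' D"
      using A' 1 by (intro 1(1)) auto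
    also have "\<dots> < h C D" using C' 1 by (intro h_strict) auto
    finally show "h A' B < h C D" .
  qed (use 1 in auto)
qed

lemma h_strict_mono:
  assumes "A \<in> L" "B \<in> L" "A \<subseteq> B" "C \<in> L" "D \<in> L" "C \<subseteq> D"
    and "lex_less (coef L A B :: 'i \<Rightarrow> enat) (coef L C D)"
  shows "h A B < h C D"
proof -
  obtain C' where C': "C' \<in> L" "C \<subset> C'" "C' \<subseteq> D"
    "(coef L A B :: 'i \<Rightarrow> enat) = coef L C' D \<or> lex_less (coef L A B :: 'i \<Rightarrow> enat) (coef L C' D)"
    using interpolate[OF assms] by metis
  then have "h A B \<le> h C' D" using assms by (intro h_mono) auto
  also have "\<dots> < h C D" using C' assms by (intro h_strict) auto
  finally show ?thesis .
qed

text \<open>At level \<open>a\<close> the finite part of \<open>[Bot, U]\<close> is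
  \<open>t a \<inter> U\<close>. Hence the coefficients of \<open>[Bot, M]\<close> and
  \<open>[Bot, U]\<close> differ by the length of \<open>[t a \<inter> U, t a]\<close>, which is
  perspective to \<open>[U, J U (t a)]\<close>.\<close>

lemma h_eq_iff:
  assumes L: "Bot \<in> L" "U \<in> L" "M \<in> L" and le: "Bot \<subseteq> U" "U \<subseteq> M"
  shows "h Bot U = h Bot M \<longleftrightarrow>
    (\<forall>K\<in>L. Bot \<subseteq> K \<longrightarrow> K \<subseteq> M \<longrightarrow> (\<forall>a::'i. rlen L a Bot K < \<infinity> \<longrightarrow> rlen L a U (J U K) = 0))"
proof -
  have leM: "Bot \<subseteq> M" using le by blast
  define t where "t a = finpart L a Bot M" for a :: 'i
  note f = finpart[OF L(1,3) leM, where 'a = 'i, folded t_def]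
  have f': "t a \<inter> U \<in> L" "Bot \<subseteq> t a \<inter> U" for a using f L le by auto
  have tU: "finpart L a Bot U = t a \<inter> U" for a
  proof (rule finpart_eqI)
    show "rlen L a Bot (t a \<inter> U) < \<infinity>"
      by (rule order_le_less_trans[OF rlen_mono f(4)]) (use f f' L in auto)
    fix T' assume "T' \<in> L" "Bot \<subseteq> T'" "T' \<subseteq> U" "rlen L a Bot T' < \<infinity>"
    then show "T' \<subseteq> t a \<inter> U" using f(5)[of T' a] le by blast
  qed (use L le f' in auto)
  have coef: "coef L Bot M a = coef L Bot U a + rlen L a (t a \<inter> U) (t a)" for a
    unfolding coef_def tU t_def[symmetric] using f(1) f' L by (intro rlen_add) auto
  have fin: "coef L Bot U a < \<infinity>" for a :: 'i using L le by (intro coef_finite) auto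
  have persp: "rlen L a U (J U (t a)) = rlen L a (t a \<inter> U) (t a)" for a
    using rlen_perspective[OF f(1) L(2), of a a] J_commute[OF f(1) L(2), of a] by simp
  \<comment> \<open>It suffices to test \<open>K = t a\<close>, which contains every
    \<open>K\<close> of finite length at level \<open>a\<close>.\<close>
  have crit: "(\<forall>K\<in>L. Bot \<subseteq> K \<longrightarrow> K \<subseteq> M \<longrightarrow> (\<forall>a::'i. rlen L a Bot K < \<infinity> \<longrightarrow> rlen L a U (J U K) = 0))
    \<longleftrightarrow> (\<forall>a. rlen L a (t a \<inter> U) (t a) = 0)" (is "?C \<longleftrightarrow> ?D")
  proof
    assume ?C
    then have "rlen L a U (J U (t a)) = 0" for a using f(1-4) by metis
    then show ?D using persp by simp
  next
    assume ?D
    have "rlen L a U (J U K) = 0"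
      if K: "K \<in> L" "Bot \<subseteq> K" "K \<subseteq> M" "rlen L a Bot K < \<infinity>" for K and a :: 'i
    proof -
      have "K \<subseteq> t a" using K by (rule f(5))
      then have "rlen L a U (J U K) \<le> rlen L a U (J U (t a))"
        using f(1) K(1) L(2) by (intro rlen_mono J_mono) (simp_all add: J_ub1)
      then show ?thesis using \<open>?D\<close> persp by simp
    qed
    then show ?C by blast
  qed
  show ?thesis
  proof (cases "\<forall>a. rlen L a (t a \<inter> U) (t a) = 0")
    case True
    then have "coef L Bot M = (coef L Bot U :: 'i \<Rightarrow> enat)" using coef by auto
    then have "h Bot U = h Bot M" using L le leM by (intro antisym h_mono) auto
    with True show ?thesis using crit by simp
  next
    case False
    \<comment> \<open>The levels at which the coefficients differ. They lie in the support of
      \<open>coef L Bot M\<close>, so a largest one exists and decides the comparison.\<close>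
    let ?S = "{a. rlen L a (t a \<inter> U) (t a) \<noteq> 0}"
    have nz: "coef L Bot M a \<noteq> 0" if "a \<in> ?S" for a using coef that by simp
    have "?S \<noteq> {}" using False by simp
    from coef_support_max[OF L(1,3) leM this nz]
    obtain a where a: "a \<in> ?S" "\<forall>b\<in>?S. b \<le> a" by (rule bexE)
    have "coef L Bot U a < coef L Bot M a"
      using a(1) fin[of a] coef[of a]
      by (cases "coef L Bot U a"; cases "rlen L a (t a \<inter> U) (t a)") (auto simp: zero_enat_def)
    moreover have "coef L Bot U b = coef L Bot M b" if "a < b" for b
      using coef[of b] a(2) that by force
    ultimately have "lex_less (coef L Bot U :: 'i \<Rightarrow> enat) (coef L Bot M)"
      unfolding lex_less_def by blast
    then have "h Bot U < h Bot M" using L le leM by (intro h_strict_mono) auto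
    then have "h Bot U \<noteq> h Bot M" by simp
    with False show ?thesis unfolding crit by blast
  qed
qed

end

section \<open>Transfer along lattice isomorphisms and embeddings of ordinals\<close>

text \<open>Length depends only on the members of the interval. So an order embedding of an upward
  closed part \<open>P\<close> suffices, provided it hits everything between two of its
  values.\<close>

lemma rlen_transfer:
  fixes a :: "'i::wellorder"
  assumes P: "P \<subseteq> L1" and up: "\<And>A C. A \<in> P \<Longrightarrow> C \<in> L1 \<Longrightarrow> A \<subseteq> C \<Longrightarrow> C \<in> P"
    and img: "\<And>A. A \<in> P \<Longrightarrow> \<phi> A \<in> L2"
    and iff: "\<And>A B. A \<in> P \<Longrightarrow> B \<in> P \<Longrightarrow> A \<subseteq> B \<longleftrightarrow> \<phi> A \<subseteq> \<phi> B"
    and surj: "\<And>A B C. A \<in> P \<Longrightarrow> B \<in> P \<Longrightarrow> C \<in> L2 \<Longrightarrow> \<phi> A \<subseteq> C \<Longrightarrow> C \<subseteq> \<phi> B \<Longrightarrow> \<exists>C'\<in>P. \<phi> C' = C"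
    and AB: "A \<in> P" "B \<in> P"
  shows "rlen L1 a A B = rlen L2 a (\<phi> A) (\<phi> B)"
  using AB
proof (induction a arbitrary: A B rule: less_induct)
  case (less a)
  have eq: "C = D \<longleftrightarrow> \<phi> C = \<phi> D" if "C \<in> P" "D \<in> P" for C D
    using iff[OF that] iff[OF that(2,1)] by auto
  have small: "small L1 a C D \<longleftrightarrow> small L2 a (\<phi> C) (\<phi> D)" if "C \<in> P" "D \<in> P" for C D
    unfolding small_def using less.IH[OF _ that] eq[OF that] by auto
  have to: "steps L2 (small L2 a) (\<phi> C) (\<phi> D) n" if "steps L1 (small L1 a) C D n" "C \<in> P" for C D n
    using that
  proof (induction rule: steps.induct)
    case (refl C)
    then show ?case by (intro steps.refl img)
  next
    case (skip C C' D n)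
    then have "C' \<in> P" using up steps_in by metis
    then show ?case
      using skip iff[of C C'] by (intro steps.skip[OF img[OF skip(5)] _ skip(4)]) simp_all
  next
    case (step C C' D n)
    then have "C' \<in> P" using up steps_in by metis
    then show ?case
      using step iff[of C C'] small[of C C'] by (intro steps.step[OF img[OF step(6)] _ _ step(5)]) simp_all
  qed
  \<comment> \<open>The end points are variables tied by equations, so that induction along the
    chain in \<open>L2\<close> can pull back each member by \<open>surj\<close>.\<close>
  have reflected: "steps L1 (small L1 a) C D n"
    if "steps L2 (small L2 a) X1 X2 n" "X1 = \<phi> C" "X2 = \<phi> D" "C \<in> P" "D \<in> P" for X1 X2 C D n
    using that
  proof (induction arbitrary: C rule: steps.induct)
    case (refl X1)
    then have "C = D" using eq by blast
    then show ?case using refl P by (auto intro: steps.refl)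
  next
    case (skip X1 X1' X2 n)
    obtain C' where C': "C' \<in> P" "\<phi> C' = X1'"
      using surj[of C D X1'] skip steps_in[OF skip(3)] by auto
    have "steps L1 (small L1 a) C' D n" by (rule skip(4)) (use C' skip in simp_all)
    moreover have "C \<subseteq> C'" using skip(2,5,7) C' iff[of C C'] by simp
    ultimately show ?case using P skip(7) by (intro steps.skip[of C _ C']) auto
  next
    case (step X1 X1' X2 n)
    obtain C' where C': "C' \<in> P" "\<phi> C' = X1'"
      using surj[of C D X1'] step steps_in[OF step(4)] by auto
    have "steps L1 (small L1 a) C' D n" by (rule step(5)) (use C' step in simp_all)
    moreover have "C \<subseteq> C'" using step(2,6,8) C' iff[of C C'] by simp
    moreover have "\<not> small L1 a C C'" using step(3,6,8) C' small[of C C'] by simp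
    ultimately show ?case using P step(8) by (intro steps.step[of C _ C']) auto
  qed
  have "steps L1 (small L1 a) A B n \<longleftrightarrow> steps L2 (small L2 a) (\<phi> A) (\<phi> B) n" for n
    using to[of A B n] reflected[of "\<phi> A" "\<phi> B" n A B] less.prems by blast
  then show ?case by (simp add: rlen_slen slen_def)
qed

text \<open>A representing well-order is carried along \<open>f\<close> by \<open>dir_image\<close>.
  This serves to bring the height ranks of two modules into one type of levels.\<close>

lemma ordinal_embedding:
  fixes f :: "'x \<Rightarrow> 'z"
  assumes "inj f"
  obtains g :: "'x ordinal \<Rightarrow> 'z ordinal" where "\<And>\<alpha> \<beta>. \<alpha> < \<beta> \<Longrightarrow> g \<alpha> < g \<beta>"
proof -
  define d where "d = (\<lambda>\<alpha> :: 'x ordinal. dir_image (rep_ordinal \<alpha>) f)"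
  \<comment> \<open>A representative lies in the domain of the partial equivalence
    \<open>ordIso\<close>, which consists of well-orders.\<close>
  have wo: "Well_order (rep_ordinal \<alpha>)" for \<alpha> :: "'x ordinal"
    by (rule ordIso_Well_order_simp[THEN conjunct1], rule Quotient_rep_reflp[OF Quotient_ordinal])
  have iso: "(rep_ordinal \<alpha>, d \<alpha>) \<in> ordIso" for \<alpha> :: "'x ordinal"
    unfolding d_def by (rule dir_image_ordIso[OF wo]) (rule inj_on_subset[OF assms subset_UNIV])
  have wod: "Well_order (d \<alpha>)" for \<alpha> by (rule ordIso_Well_order_simp[OF iso, THEN conjunct2])
  show ?thesis
  proof
    fix \<alpha> \<beta> :: "'x ordinal"
    assume "\<alpha> < \<beta>"
    then have "(rep_ordinal \<alpha>, rep_ordinal \<beta>) \<in> ordLess" by (simp add: less_ordinal_def)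
    then have "(d \<alpha>, d \<beta>) \<in> ordLess"
      using iso by (meson ordIso_ordLess_trans ordIso_symmetric ordLess_ordIso_trans)
    then show "abs_ordinal (d \<alpha>) < abs_ordinal (d \<beta>)"
      by (simp add: less_ordinal.abs_eq ordIso_reflexive wod)
  qed
qed

section \<open>The lattice of submodules and its heights\<close>

definition submodules :: "('a, 'r) ring_scheme \<Rightarrow> ('a, 'b, 'm) module_scheme \<Rightarrow> 'b set set" where
  "submodules R M = {N. submodule N R M}"

context module
begin

text \<open>Negatives are multiples by \<open>\<ominus> \<one>\<close>, and zero is the multiple of
  any member by \<open>\<zero>\<close>.\<close>

lemma submodule_iff:
  "submodule H R M \<longleftrightarrow> H \<subseteq> carrier M \<and> \<zero>\<^bsub>M\<^esub> \<in> H \<and> (\<forall>x\<in>H. \<forall>y\<in>H. x \<oplus>\<^bsub>M\<^esub> y \<in> H) \<and>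
    (\<forall>a\<in>carrier R. \<forall>x\<in>H. a \<odot>\<^bsub>M\<^esub> x \<in> H)"
proof
  assume H: "submodule H R M"
  note E = submoduleE[OF H]
  obtain x where "x \<in> H" using E(2) by blast
  then have "\<zero> \<odot>\<^bsub>M\<^esub> x \<in> H" using E(4) by blast
  then have "\<zero>\<^bsub>M\<^esub> \<in> H" using \<open>x \<in> H\<close> E(1) by auto
  with E show "H \<subseteq> carrier M \<and> \<zero>\<^bsub>M\<^esub> \<in> H \<and> (\<forall>x\<in>H. \<forall>y\<in>H. x \<oplus>\<^bsub>M\<^esub> y \<in> H) \<and>
    (\<forall>a\<in>carrier R. \<forall>x\<in>H. a \<odot>\<^bsub>M\<^esub> x \<in> H)" by blast
next
  assume H: "H \<subseteq> carrier M \<and> \<zero>\<^bsub>M\<^esub> \<in> H \<and> (\<forall>x\<in>H. \<forall>y\<in>H. x \<oplus>\<^bsub>M\<^esub> y \<in> H) \<and>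
    (\<forall>a\<in>carrier R. \<forall>x\<in>H. a \<odot>\<^bsub>M\<^esub> x \<in> H)"
  have "\<ominus>\<^bsub>M\<^esub> x \<in> H" if "x \<in> H" for x
  proof -
    have "\<ominus>\<^bsub>M\<^esub> x = (\<ominus> \<one>) \<odot>\<^bsub>M\<^esub> x" using that H by (subst smult_l_minus) auto
    then show ?thesis using that H by simp
  qed
  with H show "submodule H R M" by (intro submoduleI) auto
qed

lemma submodule_restrict_iff:
  assumes "submodule B R M"
  shows "submodule H R (M\<lparr>carrier := B\<rparr>) \<longleftrightarrow> submodule H R M \<and> H \<subseteq> B"
proof -
  interpret B: module R "M\<lparr>carrier := B\<rparr>"
    by (rule submodule.submodule_is_module[OF assms module_axioms])
  show ?thesis
    using submoduleE(1)[OF assms] unfolding B.submodule_iff submodule_iff by auto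
qed

lemma zero_submodule: "submodule {\<zero>\<^bsub>M\<^esub>} R M"
  by (simp add: submodule_iff)

lemma submodule_Int: "submodule A R M \<Longrightarrow> submodule B R M \<Longrightarrow> submodule (A \<inter> B) R M"
  by (auto simp: submodule_iff)

lemma in_set_add_iff: "z \<in> A <+>\<^bsub>M\<^esub> B \<longleftrightarrow> (\<exists>x\<in>A. \<exists>y\<in>B. z = x \<oplus>\<^bsub>M\<^esub> y)"
  by (auto simp: set_add_def')

lemma submodule_set_add:
  assumes A: "submodule A R M" and B: "submodule B R M"
  shows "submodule (A <+>\<^bsub>M\<^esub> B) R M"
  unfolding submodule_iff
proof (intro conjI ballI)
  note A' = A[unfolded submodule_iff] and B' = B[unfolded submodule_iff]
  show "A <+>\<^bsub>M\<^esub> B \<subseteq> carrier M" 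
  proof
    fix z assume "z \<in> A <+>\<^bsub>M\<^esub> B"
    then obtain a b where "a \<in> A" "b \<in> B" "z = a \<oplus>\<^bsub>M\<^esub> b" unfolding in_set_add_iff by blast
    then show "z \<in> carrier M" using A' B' by (simp add: subset_iff)
  qed
  have "\<zero>\<^bsub>M\<^esub> = \<zero>\<^bsub>M\<^esub> \<oplus>\<^bsub>M\<^esub> \<zero>\<^bsub>M\<^esub>" by simp
  then show "\<zero>\<^bsub>M\<^esub> \<in> A <+>\<^bsub>M\<^esub> B" using A' B' unfolding in_set_add_iff by blast
  fix x assume "x \<in> A <+>\<^bsub>M\<^esub> B"
  then obtain a b where x: "a \<in> A" "b \<in> B" "x = a \<oplus>\<^bsub>M\<^esub> b" by (auto simp: in_set_add_iff)
  then have ab: "a \<in> carrier M" "b \<in> carrier M" using A' B' by auto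
  show "c \<odot>\<^bsub>M\<^esub> x \<in> A <+>\<^bsub>M\<^esub> B" if "c \<in> carrier R" for c
    using that x ab A' B' smult_r_distr[of c a b] unfolding in_set_add_iff by blast
  fix y assume "y \<in> A <+>\<^bsub>M\<^esub> B"
  then obtain a' b' where y: "a' \<in> A" "b' \<in> B" "y = a' \<oplus>\<^bsub>M\<^esub> b'" by (auto simp: in_set_add_iff)
  then have "a' \<in> carrier M" "b' \<in> carrier M" using A' B' by auto
  then have "x \<oplus>\<^bsub>M\<^esub> y = (a \<oplus>\<^bsub>M\<^esub> a') \<oplus>\<^bsub>M\<^esub> (b \<oplus>\<^bsub>M\<^esub> b')"
    using x y ab by (simp add: M.a_ac)
  then show "x \<oplus>\<^bsub>M\<^esub> y \<in> A <+>\<^bsub>M\<^esub> B" using x y A' B' unfolding in_set_add_iff by blast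
qed

lemma noetherian_modular_submodules:
  assumes "wf (submodule_above R M)"
  shows "noetherian_modular (submodules R M) (set_add M)"
proof
  show "wf {(B, A). A \<in> submodules R M \<and> B \<in> submodules R M \<and> A \<subset> B}"
    using assms by (simp add: submodule_above_def submodules_def)
  fix A B assume AB: "A \<in> submodules R M" "B \<in> submodules R M"
  then have A': "submodule A R M" and B': "submodule B R M" by (auto simp: submodules_def)
  note A = A'[unfolded submodule_iff] and B = B'[unfolded submodule_iff]
  show "A \<inter> B \<in> submodules R M" "A <+>\<^bsub>M\<^esub> B \<in> submodules R M"
    using A' B' by (simp_all add: submodules_def submodule_Int submodule_set_add)
  show "A \<subseteq> A <+>\<^bsub>M\<^esub> B"
  proof
    fix x assume "x \<in> A"
    then have "x = x \<oplus>\<^bsub>M\<^esub> \<zero>\<^bsub>M\<^esub>" using A by auto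
    then show "x \<in> A <+>\<^bsub>M\<^esub> B" using \<open>x \<in> A\<close> B unfolding in_set_add_iff by blast
  qed
  show "B \<subseteq> A <+>\<^bsub>M\<^esub> B"
  proof
    fix x assume "x \<in> B"
    then have "x = \<zero>\<^bsub>M\<^esub> \<oplus>\<^bsub>M\<^esub> x" using B by auto
    then show "x \<in> A <+>\<^bsub>M\<^esub> B" using \<open>x \<in> B\<close> A unfolding in_set_add_iff by blast
  qed
  fix C assume "C \<in> submodules R M"
  then have C': "submodule C R M" by (simp add: submodules_def)
  note C = C'[unfolded submodule_iff]
  show "A <+>\<^bsub>M\<^esub> B \<subseteq> C" if "A \<subseteq> C" "B \<subseteq> C"
  proof
    fix x assume "x \<in> A <+>\<^bsub>M\<^esub> B"
    then obtain a b where "a \<in> A" "b \<in> B" "x = a \<oplus>\<^bsub>M\<^esub> b" unfolding in_set_add_iff by blast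
    then show "x \<in> C" using that C by blast
  qed
  show "(A <+>\<^bsub>M\<^esub> B) \<inter> C \<subseteq> A <+>\<^bsub>M\<^esub> (B \<inter> C)" if "A \<subseteq> C"
  proof
    fix x assume x: "x \<in> (A <+>\<^bsub>M\<^esub> B) \<inter> C"
    then obtain a b where ab: "a \<in> A" "b \<in> B" "x = a \<oplus>\<^bsub>M\<^esub> b"
      unfolding Int_iff in_set_add_iff by blast
    have "a \<in> carrier M" "b \<in> carrier M" "a \<in> C" using ab A B that by auto
    then have "b = \<ominus>\<^bsub>M\<^esub> a \<oplus>\<^bsub>M\<^esub> x" using ab(3) by (simp add: M.r_neg1)
    moreover have "\<ominus>\<^bsub>M\<^esub> a \<in> C" using submoduleE(3)[OF C' \<open>a \<in> C\<close>] .
    ultimately have "b \<in> C" using x C by blast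
    then show "x \<in> A <+>\<^bsub>M\<^esub> (B \<inter> C)" using ab unfolding in_set_add_iff by blast
  qed
qed

text \<open>The height over \<open>A\<close> inside \<open>B\<close> is computed in \<open>M\<close>
  restricted to \<open>B\<close>, whose submodules are those of \<open>M\<close> contained in
  \<open>B\<close>. Then \<open>h_least\<close> reflects the minimality in \<open>osup\<close> and
  \<open>osucc\<close>.\<close>

lemma height_modular_submodules:
  fixes r :: "'c set \<Rightarrow> 'i::wellorder"
  assumes wf: "wf (submodule_above R M)"
    and r: "\<And>A B. A \<in> submodules R M \<Longrightarrow> B \<in> submodules R M \<Longrightarrow> A \<subset> B \<Longrightarrow> r B < r A"
  shows "height_modular (submodules R M) (set_add M) r
    (\<lambda>A B. height_rank R (M\<lparr>carrier := B\<rparr>) A)"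
proof -
  interpret noetherian_modular "submodules R M" "set_add M"
    by (rule noetherian_modular_submodules[OF wf])
  have above: "(A', A) \<in> submodule_above R (M\<lparr>carrier := B\<rparr>) \<longleftrightarrow>
      A \<in> submodules R M \<and> A' \<in> submodules R M \<and> A \<subset> A' \<and> A' \<subseteq> B"
    if "B \<in> submodules R M" for A A' B
    using that submodule_restrict_iff[of B] by (auto simp: submodule_above_def submodules_def)
  have wfB: "wf (submodule_above R (M\<lparr>carrier := B\<rparr>))" if "B \<in> submodules R M" for B
    by (rule wf_subset[OF wf]) (use above[OF that] in \<open>auto simp: submodule_above_def submodules_def\<close>)
  show ?thesis
  proof
    show "r B < r A" if "A \<in> submodules R M" "B \<in> submodules R M" "A \<subset> B" for A B
      using r that by blast
  next
    fix A A' B assume "A \<in> submodules R M" "A' \<in> submodules R M" "B \<in> submodules R M" "A \<subset> A'" "A' \<subseteq> B"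
    then show "height_rank R (M\<lparr>carrier := B\<rparr>) A' < height_rank R (M\<lparr>carrier := B\<rparr>) A"
      using height_rank_unfold(2)[OF wfB, of B A' A] above by (meson less_le_trans)
  next
    fix A B and x :: "'c set ordinal"
    assume AB: "A \<in> submodules R M" "B \<in> submodules R M" "A \<subseteq> B"
      and x: "\<And>A'. A' \<in> submodules R M \<Longrightarrow> A \<subset> A' \<Longrightarrow> A' \<subseteq> B \<Longrightarrow>
        height_rank R (M\<lparr>carrier := B\<rparr>) A' < x"
    show "height_rank R (M\<lparr>carrier := B\<rparr>) A \<le> x"
      unfolding height_rank_unfold(1)[OF wfB[OF AB(2)], of A] osup_def
    proof (rule Least_le, rule ballI)
      fix \<alpha>
      assume "\<alpha> \<in> {osucc (height_rank R (M\<lparr>carrier := B\<rparr>) A') |A'.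
        (A', A) \<in> submodule_above R (M\<lparr>carrier := B\<rparr>)}"
      then obtain A' where A': "\<alpha> = osucc (height_rank R (M\<lparr>carrier := B\<rparr>) A')"
        and "(A', A) \<in> submodule_above R (M\<lparr>carrier := B\<rparr>)" by blast
      then have "height_rank R (M\<lparr>carrier := B\<rparr>) A' < x"
        using x above[OF AB(2)] by blast
      then show "\<alpha> \<le> x" unfolding A' osucc_def by (rule Least_le)
    qed
  qed
qed

text \<open>This is \<open>h_eq_iff\<close> between zero and the whole module. The type of levels is
  left free, so that two modules can be tested at the same levels.\<close>

lemma open_submodule_iff:
  fixes r :: "'c set \<Rightarrow> 'i::wellorder"
  assumes wf: "wf (submodule_above R M)"
    and r: "\<And>A B. A \<in> submodules R M \<Longrightarrow> B \<in> submodules R M \<Longrightarrow> A \<subset> B \<Longrightarrow> r B < r A"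
    and U: "submodule U R M"
  shows "open_submodule R M U \<longleftrightarrow>
    (\<forall>K\<in>submodules R M. \<forall>a::'i. rlen (submodules R M) a {\<zero>\<^bsub>M\<^esub>} K < \<infinity> \<longrightarrow>
      rlen (submodules R M) a U (U <+>\<^bsub>M\<^esub> K) = 0)"
proof -
  interpret height_modular "submodules R M" "set_add M" r "\<lambda>A B. height_rank R (M\<lparr>carrier := B\<rparr>) A"
    by (rule height_modular_submodules[OF wf r])
  have in_L: "{\<zero>\<^bsub>M\<^esub>} \<in> submodules R M" "U \<in> submodules R M" "carrier M \<in> submodules R M"
    using zero_submodule U carrier_is_submodule by (auto simp: submodules_def)
  have "\<zero>\<^bsub>M\<^esub> \<in> K \<and> K \<subseteq> carrier M" if "K \<in> submodules R M" for K
    using that by (auto simp: submodules_def submodule_iff)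
  moreover have "M\<lparr>carrier := carrier M\<rparr> = M" by simp
  ultimately show ?thesis
    using h_eq_iff[OF in_L] U in_L by (auto simp: open_submodule_def len_def)
qed

end

section \<open>Finitely generated modules over Noetherian rings\<close>

text \<open>A strictly ascending sequence of ideals would be a chain whose union is one of its
  terms, and the next term contradicts this.\<close>

lemma noetherian_ring_acc:
  assumes "noetherian_ring R"
  shows "wf {(J, I). ideal I R \<and> ideal J R \<and> I \<subset> J}"
proof -
  interpret noetherian_ring R by fact
  show ?thesis
    unfolding wf_iff_no_infinite_down_chain
  proof
    assume "\<exists>f. \<forall>i. (f (Suc i), f i) \<in> {(J, I). ideal I R \<and> ideal J R \<and> I \<subset> J}"
    then obtain f where "\<forall>i. (f (Suc i), f i) \<in> {(J, I). ideal I R \<and> ideal J R \<and> I \<subset> J}" ..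
    then have f: "\<And>i. ideal (f i) R" "\<And>i. f i \<subset> f (Suc i)" by auto
    have mono: "f i \<subseteq> f j" if "i \<le> j" for i j
      by (rule lift_Suc_mono_le[OF _ that]) (use f(2) in blast)
    have "subset.chain {I. ideal I R} (range f)"
      unfolding subset_chain_def using f(1) mono nat_le_linear by blast
    from ideal_chain_is_trivial[OF _ this] obtain i where "\<Union> (range f) = f i" by blast
    then have "f (Suc i) \<subseteq> f i" by blast
    with f(2)[of i] show False by blast
  qed
qed

context module
begin

lemma generated_submodule:
  assumes "S \<subseteq> carrier M"
  shows generated_is_submodule: "submodule (generated_submodule R M S) R M"
    and generated_superset: "S \<subseteq> generated_submodule R M S"
    and generated_least: "submodule N R M \<Longrightarrow> S \<subseteq> N \<Longrightarrow> generated_submodule R M S \<subseteq> N"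
proof -
  have "S \<subseteq> carrier M" "submodule (carrier M) R M" using assms carrier_is_submodule by auto
  then show "submodule (generated_submodule R M S) R M"
    unfolding generated_submodule_def submodule_iff by blast
qed (auto simp: generated_submodule_def)

text \<open>This is the colon ideal of all \<open>a\<close> that multiply \<open>x\<close> into the
  sum of \<open>N\<close> and \<open>G\<close>.\<close>

lemma coefficient_ideal:
  assumes x: "x \<in> carrier M" and G: "submodule G R M" and N: "submodule N R M"
  shows "ideal {a \<in> carrier R. \<exists>y\<in>G. a \<odot>\<^bsub>M\<^esub> x \<oplus>\<^bsub>M\<^esub> y \<in> N} R" (is "ideal ?I R")
proof -
  note G' = G[unfolded submodule_iff] and N' = N[unfolded submodule_iff]
  have mult: "c \<otimes> a \<in> ?I" if a: "a \<in> ?I" and c: "c \<in> carrier R" for a c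
  proof -
    obtain y where y: "a \<in> carrier R" "y \<in> G" "a \<odot>\<^bsub>M\<^esub> x \<oplus>\<^bsub>M\<^esub> y \<in> N" using a by blast
    then have "y \<in> carrier M" using G' by blast
    then have "c \<odot>\<^bsub>M\<^esub> (a \<odot>\<^bsub>M\<^esub> x \<oplus>\<^bsub>M\<^esub> y) = (c \<otimes> a) \<odot>\<^bsub>M\<^esub> x \<oplus>\<^bsub>M\<^esub> c \<odot>\<^bsub>M\<^esub> y"
      using x y c by (simp add: smult_r_distr smult_assoc1)
    then have "(c \<otimes> a) \<odot>\<^bsub>M\<^esub> x \<oplus>\<^bsub>M\<^esub> c \<odot>\<^bsub>M\<^esub> y \<in> N" "c \<odot>\<^bsub>M\<^esub> y \<in> G"
      using y N' G' c by metis+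
    then show ?thesis using y c by blast
  qed
  have zero: "\<zero> \<in> ?I"
  proof -
    have "\<zero> \<odot>\<^bsub>M\<^esub> x \<oplus>\<^bsub>M\<^esub> \<zero>\<^bsub>M\<^esub> = \<zero>\<^bsub>M\<^esub>" using x by simp
    then show ?thesis using N' G' by (metis (mono_tags, lifting) R.zero_closed mem_Collect_eq)
  qed
  have add: "a \<oplus> b \<in> ?I" if ab: "a \<in> ?I" "b \<in> ?I" for a b
  proof -
    obtain y z where y: "a \<in> carrier R" "y \<in> G" "a \<odot>\<^bsub>M\<^esub> x \<oplus>\<^bsub>M\<^esub> y \<in> N"
      and z: "b \<in> carrier R" "z \<in> G" "b \<odot>\<^bsub>M\<^esub> x \<oplus>\<^bsub>M\<^esub> z \<in> N" using ab by blast
    then have yz: "y \<in> carrier M" "z \<in> carrier M" using G' by blast+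
    have "(a \<oplus> b) \<odot>\<^bsub>M\<^esub> x \<oplus>\<^bsub>M\<^esub> (y \<oplus>\<^bsub>M\<^esub> z) = (a \<odot>\<^bsub>M\<^esub> x \<oplus>\<^bsub>M\<^esub> y) \<oplus>\<^bsub>M\<^esub> (b \<odot>\<^bsub>M\<^esub> x \<oplus>\<^bsub>M\<^esub> z)"
      using x y z yz by (simp add: smult_l_distr M.a_ac)
    then have "(a \<oplus> b) \<odot>\<^bsub>M\<^esub> x \<oplus>\<^bsub>M\<^esub> (y \<oplus>\<^bsub>M\<^esub> z) \<in> N" "y \<oplus>\<^bsub>M\<^esub> z \<in> G"
      using y z N' G' by metis+
    then show ?thesis using y z by blast
  qed
  have inv: "\<ominus> a \<in> ?I" if "a \<in> ?I" for a
  proof -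
    have "(\<ominus> \<one>) \<otimes> a \<in> ?I" by (rule mult[OF that]) simp
    then show ?thesis using that by (simp add: R.l_minus)
  qed
  show ?thesis
  proof (rule idealI[OF R.ring_axioms])
    show "subgroup ?I (add_monoid R)"
      using zero add inv by (intro R.add.subgroupI) (auto simp: a_inv_def)
    show "c \<otimes> a \<in> ?I" "a \<otimes> c \<in> ?I" if "a \<in> ?I" "c \<in> carrier R" for a c
      using mult[OF that] that R.m_comm[of a c] by auto
  qed
qed

text \<open>Given \<open>z\<close> in \<open>N'\<close>, the ideals provide a \<open>w\<close> in
  \<open>N\<close> with the same coefficient of \<open>x\<close>. The difference lies in
  \<open>N' \<inter> G\<close>, hence in \<open>N\<close>.\<close>

lemma submodule_eq_by_coefficients:
  assumes x: "x \<in> carrier M" and G: "submodule G R M" and N: "submodule N R M" "submodule N' R M"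
    and "N \<subseteq> N'" and gen: "\<And>z. z \<in> N' \<Longrightarrow> \<exists>a\<in>carrier R. \<exists>y\<in>G. z = a \<odot>\<^bsub>M\<^esub> x \<oplus>\<^bsub>M\<^esub> y"
    and I: "{a \<in> carrier R. \<exists>y\<in>G. a \<odot>\<^bsub>M\<^esub> x \<oplus>\<^bsub>M\<^esub> y \<in> N'} \<subseteq> {a \<in> carrier R. \<exists>y\<in>G. a \<odot>\<^bsub>M\<^esub> x \<oplus>\<^bsub>M\<^esub> y \<in> N}"
    and trace: "N' \<inter> G \<subseteq> N"
  shows "N' = N"
proof
  show "N' \<subseteq> N"
  proof
    fix z assume z: "z \<in> N'"
    obtain a y where a: "a \<in> carrier R" "y \<in> G" "z = a \<odot>\<^bsub>M\<^esub> x \<oplus>\<^bsub>M\<^esub> y" using gen[OF z] by blast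
    then obtain y' where y': "y' \<in> G" "a \<odot>\<^bsub>M\<^esub> x \<oplus>\<^bsub>M\<^esub> y' \<in> N" using I z by blast
    define w where "w = a \<odot>\<^bsub>M\<^esub> x \<oplus>\<^bsub>M\<^esub> y'"
    have c: "y \<in> carrier M" "y' \<in> carrier M" "z \<in> carrier M" "w \<in> carrier M"
      using a y' z submoduleE(1) G N unfolding w_def by blast+
    have "z \<oplus>\<^bsub>M\<^esub> \<ominus>\<^bsub>M\<^esub> w = y \<oplus>\<^bsub>M\<^esub> \<ominus>\<^bsub>M\<^esub> y'"
      unfolding a(3) w_def using x a c
      by (simp add: M.minus_add M.a_ac M.r_neg M.r_neg1 M.r_neg2)
    moreover have "z \<oplus>\<^bsub>M\<^esub> \<ominus>\<^bsub>M\<^esub> w \<in> N'" "y \<oplus>\<^bsub>M\<^esub> \<ominus>\<^bsub>M\<^esub> y' \<in> G"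
      using z y' a \<open>N \<subseteq> N'\<close> unfolding w_def[symmetric]
      by (auto intro!: submoduleE(5)[OF N(2)] submoduleE(5)[OF G] submoduleE(3)[OF N(2)] submoduleE(3)[OF G])
    ultimately have "z \<oplus>\<^bsub>M\<^esub> \<ominus>\<^bsub>M\<^esub> w \<in> N" using trace by auto
    then have "(z \<oplus>\<^bsub>M\<^esub> \<ominus>\<^bsub>M\<^esub> w) \<oplus>\<^bsub>M\<^esub> w \<in> N"
      using submoduleE(5)[OF N(1)] y'(2) unfolding w_def by blast
    then show "z \<in> N" using c by (simp add: M.a_assoc M.l_neg)
  qed
qed fact

text \<open>The sum of the cyclic submodule \<open>?X\<close> of multiples of \<open>x\<close> and
  \<open>?G\<close> is a submodule containing all generators.\<close>

lemma generated_insert: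
  assumes x: "x \<in> carrier M" and S: "S \<subseteq> carrier M"
    and z: "z \<in> generated_submodule R M (insert x S)"
  shows "\<exists>a\<in>carrier R. \<exists>y\<in>generated_submodule R M S. z = a \<odot>\<^bsub>M\<^esub> x \<oplus>\<^bsub>M\<^esub> y"
proof -
  let ?G = "generated_submodule R M S"
  let ?X = "(\<lambda>a. a \<odot>\<^bsub>M\<^esub> x) ` carrier R"
  have X: "submodule ?X R M"
    unfolding submodule_iff
  proof (intro conjI ballI)
    show "?X \<subseteq> carrier M" using x by auto
    have "\<zero>\<^bsub>M\<^esub> = \<zero> \<odot>\<^bsub>M\<^esub> x" using x by simp
    then show "\<zero>\<^bsub>M\<^esub> \<in> ?X" by blast
    fix u assume "u \<in> ?X"
    then obtain a where a: "a \<in> carrier R" "u = a \<odot>\<^bsub>M\<^esub> x" by blast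
    show "c \<odot>\<^bsub>M\<^esub> u \<in> ?X" if "c \<in> carrier R" for c
    proof -
      have "c \<odot>\<^bsub>M\<^esub> u = (c \<otimes> a) \<odot>\<^bsub>M\<^esub> x" using a that x by (simp add: smult_assoc1)
      then show ?thesis using a that by blast
    qed
    fix v assume "v \<in> ?X"
    then obtain b where b: "b \<in> carrier R" "v = b \<odot>\<^bsub>M\<^esub> x" by blast
    have "u \<oplus>\<^bsub>M\<^esub> v = (a \<oplus> b) \<odot>\<^bsub>M\<^esub> x" using a b x by (simp add: smult_l_distr)
    then show "u \<oplus>\<^bsub>M\<^esub> v \<in> ?X" using a b by blast
  qed
  note G = generated_is_submodule[OF S]
  have K: "submodule (?X <+>\<^bsub>M\<^esub> ?G) R M" by (rule submodule_set_add[OF X G])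
  have "insert x S \<subseteq> ?X <+>\<^bsub>M\<^esub> ?G"
  proof
    fix y assume y: "y \<in> insert x S"
    have 0: "\<zero>\<^bsub>M\<^esub> \<in> ?X" "\<zero>\<^bsub>M\<^esub> \<in> ?G" using X G submodule_iff by blast+
    have "x = \<one> \<odot>\<^bsub>M\<^esub> x" using x by simp
    then have "x \<in> ?X" by blast
    moreover have "x = x \<oplus>\<^bsub>M\<^esub> \<zero>\<^bsub>M\<^esub>" using x by simp
    moreover have "y = \<zero>\<^bsub>M\<^esub> \<oplus>\<^bsub>M\<^esub> y" using x y S by auto
    ultimately show "y \<in> ?X <+>\<^bsub>M\<^esub> ?G"
      using y 0 generated_superset[OF S] unfolding in_set_add_iff by blast
  qed
  then have "z \<in> ?X <+>\<^bsub>M\<^esub> ?G"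
    using z generated_least[OF _ K] x S by blast
  then show ?thesis unfolding in_set_add_iff by blast
qed

text \<open>Induction on the generators: by \<open>submodule_eq_by_coefficients\<close>, a proper
  enlargement of \<open>N\<close> enlarges the coefficient ideal \<open>I N\<close>, or keeps it and
  enlarges \<open>N \<inter> ?G\<close>. Both components satisfy the chain condition, hence so does
  the lexicographic product.\<close>

lemma wf_submodules_generated:
  assumes R: "noetherian_ring R" and "finite S" and "S \<subseteq> carrier M"
  shows "wf {(N', N). submodule N R M \<and> submodule N' R M \<and> N \<subset> N' \<and> N' \<subseteq> generated_submodule R M S}"
  using assms(2,3)
proof (induction S rule: finite_induct)
  case empty
  have "generated_submodule R M {} \<subseteq> {\<zero>\<^bsub>M\<^esub>}"
    by (intro generated_least zero_submodule) auto
  then have "{(N', N). submodule N R M \<and> submodule N' R M \<and> N \<subset> N' \<and> N' \<subseteq> generated_submodule R M {}} = {}"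
    using submodule_iff by blast
  then show ?case by (rule ssubst) simp
next
  case (insert x S)
  let ?G = "generated_submodule R M S"
  define I where "I N = {a \<in> carrier R. \<exists>y\<in>?G. a \<odot>\<^bsub>M\<^esub> x \<oplus>\<^bsub>M\<^esub> y \<in> N}" for N
  let ?A = "{(J, I). ideal I R \<and> ideal J R \<and> I \<subset> J}"
  let ?B = "{(N', N). submodule N R M \<and> submodule N' R M \<and> N \<subset> N' \<and> N' \<subseteq> ?G}"
  have x: "x \<in> carrier M" and S: "S \<subseteq> carrier M" using insert by auto
  note G = generated_is_submodule[OF S]
  have "wf (inv_image (?A <*lex*> ?B) (\<lambda>N. (I N, N \<inter> ?G)))"
    by (intro wf_inv_image wf_lex_prod noetherian_ring_acc[OF R] insert.IH[OF S])
  then show ?case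
  proof (rule wf_subset, intro subrelI)
    fix N' N
    assume "(N', N) \<in> {(N', N). submodule N R M \<and> submodule N' R M \<and> N \<subset> N' \<and>
      N' \<subseteq> generated_submodule R M (insert x S)}"
    then have N: "submodule N R M" "submodule N' R M" and sub: "N \<subset> N'"
      and gen: "N' \<subseteq> generated_submodule R M (insert x S)" by auto
    have ideals: "ideal (I N) R" "ideal (I N') R"
      unfolding I_def using coefficient_ideal[OF x G] N by auto
    have "I N \<subseteq> I N'" using sub unfolding I_def by blast
    moreover have "I N' = I N \<Longrightarrow> N' \<inter> ?G \<noteq> N \<inter> ?G"
    proof
      assume "I N' = I N" "N' \<inter> ?G = N \<inter> ?G"
      then have "N' = N"
        using gen sub N by (intro submodule_eq_by_coefficients[OF x G])
          (auto simp: I_def intro!: generated_insert[OF x S])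
      with sub show False by blast
    qed
    moreover have "submodule (N \<inter> ?G) R M" "submodule (N' \<inter> ?G) R M"
      using N G submodule_Int by auto
    ultimately show "(N', N) \<in> inv_image (?A <*lex*> ?B) (\<lambda>N. (I N, N \<inter> ?G))"
      using ideals sub by auto
  qed
qed

end

lemma wf_submodule_above:
  assumes "noetherian_ring R" "fin_gen_module R M"
  shows "wf (submodule_above R M)"
proof -
  interpret module R M using assms by (simp add: fin_gen_module_def)
  obtain S where S: "S \<subseteq> carrier M" "finite S" "carrier M = generated_submodule R M S"
    using assms by (auto simp: fin_gen_module_def)
  show ?thesis
    by (rule wf_subset[OF wf_submodules_generated[OF assms(1) S(2,1)]])
      (use submoduleE(1) S(3) in \<open>auto simp: submodule_above_def\<close>)
qed

section \<open>Preimages of open submodules\<close>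

locale module_hom = M?: module R M + N?: module R N
  for R :: "('a, 'r) ring_scheme" (structure)
    and M :: "('a, 'b, 'm) module_scheme" (structure)
    and N :: "('a, 'c, 'n) module_scheme" (structure) +
  fixes f
  assumes hom: "f \<in> mod_hom R M N"
begin

lemma f_closed [simp]: "x \<in> carrier M \<Longrightarrow> f x \<in> carrier N"
  and f_add: "x \<in> carrier M \<Longrightarrow> y \<in> carrier M \<Longrightarrow> f (x \<oplus>\<^bsub>M\<^esub> y) = f x \<oplus>\<^bsub>N\<^esub> f y"
  and f_smult: "a \<in> carrier R \<Longrightarrow> x \<in> carrier M \<Longrightarrow> f (a \<odot>\<^bsub>M\<^esub> x) = a \<odot>\<^bsub>N\<^esub> f x"
  using hom by (auto simp: mod_hom_def hom_def)

lemma f_zero [simp]: "f \<zero>\<^bsub>M\<^esub> = \<zero>\<^bsub>N\<^esub>"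
  using f_smult[of "\<zero>\<^bsub>R\<^esub>" "\<zero>\<^bsub>M\<^esub>"] by simp

lemma submodule_preimage:
  "submodule V R N \<Longrightarrow> submodule (f -` V \<inter> carrier M) R M"
  by (simp add: M.submodule_iff N.submodule_iff f_add f_smult)

lemma submodule_image:
  assumes "submodule A R M"
  shows "submodule (f ` A) R N"
  unfolding N.submodule_iff
proof (intro conjI ballI)
  note A = assms[unfolded M.submodule_iff]
  show "f ` A \<subseteq> carrier N" using A by auto
  show "\<zero>\<^bsub>N\<^esub> \<in> f ` A" using A f_zero by (metis imageI)
  fix u assume "u \<in> f ` A"
  then obtain x where x: "x \<in> A" "u = f x" by blast
  show "a \<odot>\<^bsub>N\<^esub> u \<in> f ` A" if "a \<in> carrier R" for a
    using x A that f_smult[of a x] by (metis imageI subsetD)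
  fix v assume "v \<in> f ` A"
  then obtain y where "y \<in> A" "v = f y" by blast
  then show "u \<oplus>\<^bsub>N\<^esub> v \<in> f ` A" using x A f_add[of x y] by (metis imageI subsetD)
qed

abbreviation "ker \<equiv> f -` {\<zero>\<^bsub>N\<^esub>} \<inter> carrier M"

text \<open>If \<open>f x = f y\<close> with \<open>y\<close> in \<open>B\<close>, then
  \<open>x\<close> and \<open>y\<close> differ by an element of the kernel, which lies in
  \<open>B\<close>.\<close>

lemma submodule_image_subset_iff:
  assumes "submodule A R M" "submodule B R M" "ker \<subseteq> B"
  shows "A \<subseteq> B \<longleftrightarrow> f ` A \<subseteq> f ` B"
proof
  assume sub: "f ` A \<subseteq> f ` B"
  show "A \<subseteq> B"
  proof
    fix x assume x: "x \<in> A"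
    then obtain y where y: "y \<in> B" "f x = f y" using sub by blast
    have c: "x \<in> carrier M" "y \<in> carrier M" using x y assms M.submoduleE(1) by blast+
    have my: "\<ominus>\<^bsub>M\<^esub> y = (\<ominus>\<^bsub>R\<^esub> \<one>\<^bsub>R\<^esub>) \<odot>\<^bsub>M\<^esub> y" using c by (simp add: M.smult_l_minus)
    have "f (x \<oplus>\<^bsub>M\<^esub> \<ominus>\<^bsub>M\<^esub> y) = f x \<oplus>\<^bsub>N\<^esub> \<ominus>\<^bsub>N\<^esub> f y"
      using c by (simp add: f_add my f_smult N.smult_l_minus)
    also have "\<dots> = \<zero>\<^bsub>N\<^esub>" using y c by (simp add: N.M.r_neg)
    finally have "x \<oplus>\<^bsub>M\<^esub> \<ominus>\<^bsub>M\<^esub> y \<in> B" using assms(3) c by auto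
    then have "(x \<oplus>\<^bsub>M\<^esub> \<ominus>\<^bsub>M\<^esub> y) \<oplus>\<^bsub>M\<^esub> y \<in> B" using y M.submoduleE(5)[OF assms(2)] by blast
    then show "x \<in> B" using c by (simp add: M.M.a_assoc M.M.l_neg)
  qed
qed (rule image_mono)

text \<open>The correspondence theorem: on submodules above the kernel, taking images preserves and
  reflects inclusion, and preimages supply everything between two images.\<close>

lemma rlen_image:
  fixes a :: "'i::wellorder"
  assumes "A \<in> submodules R M" "B \<in> submodules R M" "ker \<subseteq> A" "ker \<subseteq> B"
  shows "rlen (submodules R M) a A B = rlen (submodules R N) a (f ` A) (f ` B)"
proof (rule rlen_transfer[where P = "{A \<in> submodules R M. ker \<subseteq> A}"])
  fix A B C
  assume A: "A \<in> {A \<in> submodules R M. ker \<subseteq> A}" and B: "B \<in> {A \<in> submodules R M. ker \<subseteq> A}"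
  show "A \<subseteq> B \<longleftrightarrow> f ` A \<subseteq> f ` B"
    using A B by (intro submodule_image_subset_iff) (auto simp: submodules_def)
  assume C: "C \<in> submodules R N" "f ` A \<subseteq> C" "C \<subseteq> f ` B"
  have "B \<subseteq> carrier M" using B M.submoduleE(1) by (auto simp: submodules_def)
  then have "f ` (f -` C \<inter> carrier M) = C" using C(3) by blast
  moreover have "f -` C \<inter> carrier M \<in> submodules R M"
    using C by (simp add: submodules_def submodule_preimage)
  moreover have "\<zero>\<^bsub>N\<^esub> \<in> C" using C(1) by (simp add: submodules_def N.submodule_iff)
  ultimately show "\<exists>C'\<in>{A \<in> submodules R M. ker \<subseteq> A}. f ` C' = C"
    by (intro bexI[of _ "f -` C \<inter> carrier M"]) auto
qed (use assms in \<open>auto simp: submodules_def submodule_image\<close>)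

text \<open>The criterion for \<open>?W\<close> is checked on a given \<open>K\<close> by enlarging
  it by the kernel, passing to the image, using openness of \<open>V\<close> there, and pulling the
  vanishing length back.\<close>

lemma open_submodule_preimage:
  assumes wfM: "wf (submodule_above R M)" and wfN: "wf (submodule_above R N)"
    and V: "open_submodule R N V"
  shows "open_submodule R M (f -` V \<inter> carrier M)"
proof -
  interpret LM: noetherian_modular "submodules R M" "set_add M"
    by (rule M.noetherian_modular_submodules[OF wfM])
  interpret LN: noetherian_modular "submodules R N" "set_add N"
    by (rule N.noetherian_modular_submodules[OF wfN])
  \<comment> \<open>The height ranks of \<open>M\<close> and \<open>N\<close> live in different
    ordinal types; ordinals over the sum type serve as common levels for both criteria.\<close>
  obtain gM :: "'b set ordinal \<Rightarrow> ('b set + 'c set) ordinal" where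
    gM: "\<And>x y. x < y \<Longrightarrow> gM x < gM y" using ordinal_embedding[OF inj_Inl] by blast
  obtain gN :: "'c set ordinal \<Rightarrow> ('b set + 'c set) ordinal" where
    gN: "\<And>x y. x < y \<Longrightarrow> gN x < gN y" using ordinal_embedding[OF inj_Inr] by blast
  have rM: "gM (height_rank R M B) < gM (height_rank R M A)"
    if "A \<in> submodules R M" "B \<in> submodules R M" "A \<subset> B" for A B
    using that height_rank_unfold(2)[OF wfM, of B A]
    by (intro gM) (auto simp: submodule_above_def submodules_def intro: less_le_trans)
  have rN: "gN (height_rank R N B) < gN (height_rank R N A)"
    if "A \<in> submodules R N" "B \<in> submodules R N" "A \<subset> B" for A B
    using that height_rank_unfold(2)[OF wfN, of B A]
    by (intro gN) (auto simp: submodule_above_def submodules_def intro: less_le_trans)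
  have V': "submodule V R N" using V by (simp add: open_submodule_def)
  let ?W = "f -` V \<inter> carrier M"
  have in_L: "ker \<in> submodules R M" "?W \<in> submodules R M" "V \<in> submodules R N"
      "{\<zero>\<^bsub>M\<^esub>} \<in> submodules R M"
    using V' by (simp_all add: submodules_def submodule_preimage N.zero_submodule M.zero_submodule)
  have kerW: "ker \<subseteq> ?W" using V' by (auto simp: N.submodule_iff)
  have "rlen (submodules R M) a ?W (?W <+>\<^bsub>M\<^esub> K) = 0"
    if K: "K \<in> submodules R M" and fin: "rlen (submodules R M) a {\<zero>\<^bsub>M\<^esub>} K < \<infinity>"
    for K and a :: "('b set + 'c set) ordinal"
  proof -
    let ?X = "ker <+>\<^bsub>M\<^esub> K"
    have X: "?X \<in> submodules R M" "ker \<subseteq> ?X" "K \<subseteq> ?X"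
      using in_L K by (simp_all add: LM.J_ub1 LM.J_ub2)
    have fX: "f ` ?X \<in> submodules R N"
      using X(1) by (simp add: submodules_def submodule_image)
    have "\<zero>\<^bsub>M\<^esub> \<in> K" using K by (simp add: submodules_def M.submodule_iff)
    then have le: "rlen (submodules R M) a (K \<inter> ker) K \<le> rlen (submodules R M) a {\<zero>\<^bsub>M\<^esub>} K"
      using K in_L by (intro LM.rlen_mono) auto
    \<comment> \<open>By perspectivity, \<open>?X\<close> has finite length over the kernel because
      \<open>K\<close> has finite length over \<open>K \<inter> ker\<close>.\<close>
    have "rlen (submodules R M) a ker ?X = rlen (submodules R M) a (K \<inter> ker) K"
      unfolding LM.rlen_perspective[OF K in_L(1)] LM.J_commute[OF K in_L(1)] ..
    then have "rlen (submodules R M) a ker ?X < \<infinity>"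
      using order_le_less_trans[OF le fin] by (simp only:)
    moreover have "f ` ker = {\<zero>\<^bsub>N\<^esub>}" using f_zero by (auto intro!: image_eqI[of _ _ "\<zero>\<^bsub>M\<^esub>"])
    ultimately have "rlen (submodules R N) a {\<zero>\<^bsub>N\<^esub>} (f ` ?X) < \<infinity>"
      using rlen_image[OF in_L(1) X(1) _ X(2), of a] by simp
    \<comment> \<open>The criterion for the open \<open>V\<close>, tested on the image of
      \<open>?X\<close>.\<close>
    then have "rlen (submodules R N) a V (V <+>\<^bsub>N\<^esub> f ` ?X) = 0"
      using V fX N.open_submodule_iff[OF wfN, where r = "\<lambda>A. gN (height_rank R N A)", OF rN V'] by blast
    then have "rlen (submodules R N) a (f ` ?X \<inter> V) (f ` ?X) = 0"
      using LN.rlen_perspective[OF fX in_L(3), of a] LN.J_commute[OF fX in_L(3)] by simp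
    \<comment> \<open>This exhibits the lower end as the image of \<open>?X \<inter> ?W\<close>,
      which contains the kernel, so the length can be read off in \<open>M\<close>.\<close>
    moreover have "f ` ?X \<inter> V = f ` (?X \<inter> ?W)"
      using X(1) M.submoduleE(1)[of ?X] by (auto simp: submodules_def)
    ultimately have "rlen (submodules R M) a (?X \<inter> ?W) ?X = 0"
      using rlen_image[of "?X \<inter> ?W" ?X a] X in_L kerW by (auto simp: Int_commute)
    then have "rlen (submodules R M) a ?W (?W <+>\<^bsub>M\<^esub> ?X) = 0"
      using LM.rlen_perspective[OF X(1) in_L(2), of a] LM.J_commute[OF X(1) in_L(2)] by simp
    \<comment> \<open>The original \<open>K\<close> lies in \<open>?X\<close>, so monotonicity
      returns to it.\<close>
    moreover have "rlen (submodules R M) a ?W (?W <+>\<^bsub>M\<^esub> K) \<le> rlen (submodules R M) a ?W (?W <+>\<^bsub>M\<^esub> ?X)"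
      using in_L X K by (intro LM.rlen_mono LM.J_mono LM.J_in LM.J_ub1) auto
    ultimately show ?thesis by simp
  qed
  then show ?thesis
    using M.open_submodule_iff[OF wfM, where r = "\<lambda>A. gM (height_rank R M A)", OF rM, of ?W] in_L by (auto simp: submodules_def)
qed

end

lemma wf_submodule_above_restrict:
  assumes "module R M" "wf (submodule_above R M)" "submodule N R M"
  shows "wf (submodule_above R (M\<lparr>carrier := N\<rparr>))"
  by (rule wf_subset[OF assms(2)])
    (auto simp: submodule_above_def module.submodule_restrict_iff[OF assms(1,3)])

theorem theorem6p1:
  fixes R :: "('a, 'r) ring_scheme"
  assumes "cring R" and "noetherian_ring R" and "krull_dim R < \<infinity>"
  shows "(\<forall>(M :: ('a, 'b) module) (N :: ('a, 'c) module) f V.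
            fin_gen_module R M \<and> fin_gen_module R N \<and> f \<in> mod_hom R M N \<and>
            open_submodule R N V
            \<longrightarrow> open_submodule R M (f -` V \<inter> carrier M))
       \<and> (\<forall>(M :: ('a, 'd) module) U N.
            fin_gen_module R M \<and> open_submodule R M U \<and> submodule N R M
            \<longrightarrow> open_submodule R (M\<lparr>carrier := N\<rparr>) (N \<inter> U))"
proof (intro conjI allI impI; elim conjE)
  fix M :: "('a, 'b) module" and N :: "('a, 'c) module" and f V
  assume *: "fin_gen_module R M" "fin_gen_module R N" "f \<in> mod_hom R M N" "open_submodule R N V"
  then interpret module_hom R M N f
    by (simp add: module_hom_def module_hom_axioms_def fin_gen_module_def)
  show "open_submodule R M (f -` V \<inter> carrier M)"
    using * assms(2) by (intro open_submodule_preimage wf_submodule_above)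
next
  fix M :: "('a, 'd) module" and U N
  assume M: "fin_gen_module R M" and U: "open_submodule R M U" and N: "submodule N R M"
  interpret M: module R M using M by (simp add: fin_gen_module_def)
  have mod_N: "module R (M\<lparr>carrier := N\<rparr>)"
    by (rule submodule.submodule_is_module[OF N M.module_axioms])
  \<comment> \<open>The inclusion of \<open>N\<close> into \<open>M\<close>, under which the
    preimage of \<open>U\<close> is \<open>N \<inter> U\<close>. The chain condition for
    \<open>N\<close> is inherited from \<open>M\<close>.\<close>
  have "id \<in> mod_hom R (M\<lparr>carrier := N\<rparr>) M"
    using M.submoduleE(1)[OF N] by (auto simp: mod_hom_def hom_def)
  then have hom_id: "module_hom R (M\<lparr>carrier := N\<rparr>) M id"
    using mod_N M.module_axioms by (simp add: module_hom_def module_hom_axioms_def)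
  note wf = wf_submodule_above[OF assms(2) M]
  have "open_submodule R (M\<lparr>carrier := N\<rparr>) (id -` U \<inter> carrier (M\<lparr>carrier := N\<rparr>))"
    by (rule module_hom.open_submodule_preimage[OF hom_id wf_submodule_above_restrict[OF M.module_axioms wf N] wf U])
  then show "open_submodule R (M\<lparr>carrier := N\<rparr>) (N \<inter> U)"
    by (simp add: Int_commute)
qed

end
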